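(* Let $\psi_n$ be a bounded sequence in $W^{1,2}(\Omega;\mathbb{R}^m)$ and let $\alpha_n>0$ be such that $\phi_n=\alpha_n\psi_n$ is bounded in $W^{1,\infty}(\Omega;\mathbb{R}^m)$. Set $R=\sup_n\|\nabla\phi_n\|_\infty$. Then there exist: - a subsequence (not relabeled); - a nonnegative Radon measure $\pi$ on $\overline\Omega$; - families of probability measures $\{\mu_x\}_{x\in\overline\Omega}$ supported on the closed ball $\overline{\mathcal B(0,R)}\subset\mathbb{R}^{m\times d}$ and $\{\lambda_x\}_{x\in\overline\Omega}$ supported on the unit sphere $\mathcal S\subset\mathbb{R}^{m\times d}$, such that for every continuous $U:\overline\Omega\times\mathbb{R}^{m\times d}\to\mathbb{R}$ with $U(x,0)=0$ and every continuous fourth-order tensor field $\mathsf L$ on $\overline\Omega$, $$\mathcal F(x,\alpha_n,\nabla\psi_n(x))\,dx\ \overset{*}{\rightharpoonup}\ \mathcal I(x,\mu_x,\lambda_x)\,d\pi(x)$$ in the sense of measures on $\overline\Omega$. In particular, $|\nabla\psi_n|^2dx\overset{*}{\rightharpoonup}\pi$.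
   Context: $\Omega\subset\mathbb{R}^d$ is a bounded domain with $C^1$ boundary. $(A,B)=\mathrm{tr}(AB^T)$ and $|\cdot|$ is the Frobenius norm on $\mathbb{R}^{m\times d}$. For continuous $U:\overline\Omega\times\mathbb{R}^{m\times d}\to\mathbb{R}$ with $U(x,0)=0$ and a continuous map $\mathsf L$ from $\overline\Omega$ to linear maps on $\mathbb{R}^{m\times d}$: - $\mathcal F(x,\alpha,G)=U(x,\alpha G)|G|^2+\tfrac12(\mathsf L(x)G,G)$ for $x\in\overline\Omega$, $\alpha>0$, $G\in\mathbb{R}^{m\times d}$; - for a probability measure $\mu$ on $\overline{\mathcal B(0,R)}$ and a probability measure $\lambda$ on the unit sphere $\mathcal S$ of $\mathbb{R}^{m\times d}$, $\mathcal I(x,\mu,\lambda)=\int_{\overline{\mathcal B(0,R)}}U(x,F)\,d\mu(F)+\tfrac12\int_{\mathcal S}(\mathsf L(x)F,F)\,d\lambda(F)$. *)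

theory Defs
  imports "HOL-Analysis.Analysis" "HOL-Probability.Probability"
begin

definition partial_deriv :: "'d::finite \<Rightarrow> (real^'d \<Rightarrow> real) \<Rightarrow> real^'d \<Rightarrow> real" where
  "partial_deriv j f x = frechet_derivative f (at x) (axis j 1)"

fun C_k :: "nat \<Rightarrow> (real^'d::finite) set \<Rightarrow> (real^'d \<Rightarrow> real) \<Rightarrow> bool" where
  "C_k 0 S f = continuous_on S f"
| "C_k (Suc k) S f = ((\<forall>x\<in>S. f differentiable (at x)) \<and> (\<forall>j. C_k k S (partial_deriv j f)))"

definition test_fun :: "(real^'d::finite) set \<Rightarrow> (real^'d \<Rightarrow> real) \<Rightarrow> bool" where
  "test_fun \<Omega> \<phi> \<longleftrightarrow> (\<forall>k. C_k k UNIV \<phi>) \<and> compact (closure {x. \<phi> x \<noteq> 0}) \<and> closure {x. \<phi> x \<noteq> 0} \<subseteq> \<Omega>"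

definition weak_gradient ::
  "(real^'d::finite) set \<Rightarrow> (real^'d \<Rightarrow> real^'m::finite) \<Rightarrow> (real^'d \<Rightarrow> real^'d^'m) \<Rightarrow> bool" where
  "weak_gradient \<Omega> \<psi> G \<longleftrightarrow>
     (\<forall>\<phi>. test_fun \<Omega> \<phi> \<longrightarrow> (\<forall>i j.
        integrable (lebesgue_on \<Omega>) (\<lambda>x. \<psi> x $ i * partial_deriv j \<phi> x) \<and>
        integrable (lebesgue_on \<Omega>) (\<lambda>x. G x $ i $ j * \<phi> x) \<and>
        (\<integral>x. \<psi> x $ i * partial_deriv j \<phi> x \<partial>lebesgue_on \<Omega>)
          = - (\<integral>x. G x $ i $ j * \<phi> x \<partial>lebesgue_on \<Omega>)))"

definition W12 ::
  "(real^'d::finite) set \<Rightarrow> (real^'d \<Rightarrow> real^'m::finite) \<Rightarrow> (real^'d \<Rightarrow> real^'d^'m) \<Rightarrow> bool" where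
  "W12 \<Omega> \<psi> G \<longleftrightarrow> \<psi> \<in> borel_measurable (lebesgue_on \<Omega>) \<and> G \<in> borel_measurable (lebesgue_on \<Omega>) \<and>
     integrable (lebesgue_on \<Omega>) (\<lambda>x. (norm (\<psi> x))\<^sup>2) \<and>
     integrable (lebesgue_on \<Omega>) (\<lambda>x. (norm (G x))\<^sup>2) \<and> weak_gradient \<Omega> \<psi> G"

definition W12_norm_sq ::
  "(real^'d::finite) set \<Rightarrow> (real^'d \<Rightarrow> real^'m::finite) \<Rightarrow> (real^'d \<Rightarrow> real^'d^'m) \<Rightarrow> real" where
  "W12_norm_sq \<Omega> \<psi> G = (\<integral>x. (norm (\<psi> x))\<^sup>2 \<partial>lebesgue_on \<Omega>) + (\<integral>x. (norm (G x))\<^sup>2 \<partial>lebesgue_on \<Omega>)"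

definition ess_norm :: "(real^'d::finite) set \<Rightarrow> (real^'d \<Rightarrow> 'b::real_normed_vector) \<Rightarrow> ereal" where
  "ess_norm \<Omega> f = esssup (lebesgue_on \<Omega>) (\<lambda>x. ereal (norm (f x)))"

definition W1inf ::
  "(real^'d::finite) set \<Rightarrow> (real^'d \<Rightarrow> real^'m::finite) \<Rightarrow> (real^'d \<Rightarrow> real^'d^'m) \<Rightarrow> bool" where
  "W1inf \<Omega> \<phi> G \<longleftrightarrow> \<phi> \<in> borel_measurable (lebesgue_on \<Omega>) \<and> G \<in> borel_measurable (lebesgue_on \<Omega>) \<and>
     ess_norm \<Omega> \<phi> < \<infinity> \<and> ess_norm \<Omega> G < \<infinity> \<and> weak_gradient \<Omega> \<phi> G"

definition C1_boundary :: "(real^'d::finite) set \<Rightarrow> bool" where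
  "C1_boundary \<Omega> \<longleftrightarrow> (\<forall>p\<in>frontier \<Omega>. \<exists>r>0. \<exists>f f'.
      (\<forall>x\<in>ball p r. (f has_derivative blinfun_apply (f' x)) (at x)) \<and>
      continuous_on (ball p r) f' \<and> (\<forall>x\<in>ball p r. f' x \<noteq> 0) \<and>
      \<Omega> \<inter> ball p r = {x\<in>ball p r. f x < (0::real)})"

definition bounded_C1_domain :: "(real^'d::finite) set \<Rightarrow> bool" where
  "bounded_C1_domain \<Omega> \<longleftrightarrow> open \<Omega> \<and> connected \<Omega> \<and> \<Omega> \<noteq> {} \<and> bounded \<Omega> \<and> C1_boundary \<Omega>"

definition calF :: "(real^'d \<Rightarrow> real^'d^'m \<Rightarrow> real) \<Rightarrow> (real^'d \<Rightarrow> ((real^'d^'m) \<Rightarrow>\<^sub>L (real^'d^'m)))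
     \<Rightarrow> real^'d \<Rightarrow> real \<Rightarrow> real^'d^'m \<Rightarrow> real" where
  "calF U L x \<alpha> G = U x (\<alpha> *\<^sub>R G) * (norm G)\<^sup>2 + 1/2 * inner (blinfun_apply (L x) G) G"

definition calI :: "(real^'d \<Rightarrow> real^'d^'m \<Rightarrow> real) \<Rightarrow> (real^'d \<Rightarrow> ((real^'d^'m) \<Rightarrow>\<^sub>L (real^'d^'m)))
     \<Rightarrow> real^'d \<Rightarrow> (real^'d^'m) measure \<Rightarrow> (real^'d^'m) measure \<Rightarrow> real" where
  "calI U L x \<mu> lm = (\<integral>F. U x F \<partial>\<mu>) + 1/2 * (\<integral>F. inner (blinfun_apply (L x) F) F \<partial>lm)"

definition weak_star_conv :: "(real^'d::finite) set \<Rightarrow> (nat \<Rightarrow> real^'d \<Rightarrow> real) \<Rightarrow> (real^'d) measure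
     \<Rightarrow> (real^'d \<Rightarrow> real) \<Rightarrow> bool" where
  "weak_star_conv \<Omega> f \<nu> g \<longleftrightarrow>
     (\<forall>n. integrable (lebesgue_on \<Omega>) (f n)) \<and> integrable \<nu> g \<and>
     (\<forall>\<phi>. continuous_on (closure \<Omega>) \<phi> \<longrightarrow>
        (\<lambda>n. \<integral>x. \<phi> x * f n x \<partial>lebesgue_on \<Omega>) \<longlonglongrightarrow> (\<integral>x. \<phi> x * g x \<partial>\<nu>))"

end

theory Submission
  imports Defs
begin

text \<open>
  The measures \<open>|\<nabla>\<psi>\<^sub>n|\<^sup>2 dx\<close> are pushed forward by \<open>x \<mapsto> (x, \<alpha>\<^sub>n \<nabla>\<psi>\<^sub>n, \<nabla>\<psi>\<^sub>n / |\<nabla>\<psi>\<^sub>n|)\<close> to the compact set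
  \<open>closure \<Omega> \<times> cball 0 R \<times> sphere 0 1\<close>. Their masses are bounded, so a subsequence converges
  weakly; \<open>\<pi>\<close> is the first marginal of the limit, and \<open>\<mu>\<^sub>x\<close>, \<open>\<lambda>\<^sub>x\<close> are obtained by disintegrating
  its marginals on \<open>(x, A)\<close> and \<open>(x, e)\<close>. The quadratic homogeneity of \<open>(L(x)G, G)\<close> makes \<open>\<F>\<close> an integral
  of the continuous function \<open>U(x, A) + (L(x)e, e)/2\<close> against the pushed-forward measure.

  Weak compactness and disintegration are both reduced to the real line: a compact set \<open>K\<close> has
  a Borel coding into the reals with a continuous left inverse, and there Helly's selection theorem and
  conditional distribution functions are available.
\<close>

section \<open>Coding a compact set by real numbers\<close>

text \<open>Let j be the first index at which the digits differ. Its term has size (1/3)^j, while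
  all later terms together amount to at most (1/3)^j/2, so half of the leading term survives. Base 3
  is what leaves this gap: in base 2 the tail could cancel the leading term completely.\<close>

lemma base3_bits_gap:
  fixes b c :: "nat \<Rightarrow> bool"
  assumes k: "k \<le> n" "b k \<noteq> c k"
  shows "\<bar>(\<Sum>i. of_bool (b i) * (1/3::real)^i) - (\<Sum>i. of_bool (c i) * (1/3)^i)\<bar> \<ge> (1/3)^n / 2"
proof -
  define j where "j = (LEAST k. b k \<noteq> c k)"
  have j: "b j \<noteq> c j" unfolding j_def by (rule LeastI) fact
  have jn: "j \<le> n" using Least_le[of "\<lambda>k. b k \<noteq> c k" k] k unfolding j_def by simp
  have eq: "b i = c i" if "i < j" for i using not_less_Least that unfolding j_def by blast
  define d where "d i = (of_bool (b i) - of_bool (c i)) * (1/3::real)^i" for i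
  have g: "summable (\<lambda>i. (1/3::real)^i)" by (simp add: summable_geometric)
  have sm: "summable (\<lambda>i. of_bool (x i) * (1/3::real)^i)" for x :: "nat \<Rightarrow> bool"
    by (rule summable_comparison_test'[OF g]) auto
  have dd: "d = (\<lambda>i. of_bool (b i) * (1/3::real)^i - of_bool (c i) * (1/3)^i)"
    by (auto simp: d_def algebra_simps)
  have sd: "summable d" unfolding dd by (intro summable_diff sm)
  have dif: "(\<Sum>i. of_bool (b i) * (1/3::real)^i) - (\<Sum>i. of_bool (c i) * (1/3)^i) = suminf d"
    unfolding dd by (intro suminf_diff sm)
  have "suminf d = (\<Sum>i. d (i + Suc j)) + sum d {..<Suc j}"
    by (rule suminf_split_initial_segment[OF sd])
  also have "sum d {..<Suc j} = d j" using eq by (simp add: d_def)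
  finally have s: "suminf d = (\<Sum>i. d (i + Suc j)) + d j" .
  have gt: "(\<lambda>i. (1/3::real)^(i + Suc j)) sums ((1/3)^j/2)"
  proof -
    have "(\<lambda>i. (1/3)^Suc j * (1/3::real)^i) sums ((1/3)^Suc j * (1/(1-1/3)))"
      by (intro sums_mult geometric_sums) simp
    then show ?thesis by (simp add: power_add mult.commute field_simps)
  qed
  have bd: "norm (d i) \<le> (1/3)^i" for i by (auto simp: d_def of_bool_def)
  have "norm (\<Sum>i. d (i + Suc j)) \<le> (\<Sum>i. (1/3::real)^(i + Suc j))"
    by (rule norm_suminf_le[OF bd sums_summable[OF gt]])
  then have "\<bar>\<Sum>i. d (i + Suc j)\<bar> \<le> (1/3)^j/2" unfolding sums_unique[OF gt, symmetric] real_norm_def .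
  moreover have "\<bar>d j\<bar> = (1/3)^j" using j by (auto simp: d_def)
  ultimately have "\<bar>suminf d\<bar> \<ge> (1/3)^j/2" unfolding s by linarith
  moreover have "(1/3::real)^n \<le> (1/3)^j" using jn by (intro power_decreasing) auto
  ultimately show ?thesis unfolding dif by linarith
qed

text \<open>The digits of \<open>s x\<close> record which balls of a countable family contain
  \<open>x\<close>; this makes \<open>s\<close> Borel, with no claim of continuity. On
  \<open>K\<close> finitely many digits locate a point up to any given error, by compactness.
  Decoding is therefore uniformly continuous on the image of \<open>K\<close> and extends to its
  closure, then by Tietze to the whole line.\<close>

lemma compact_real_coding:
  fixes K :: "'b::euclidean_space set"
  assumes K: "compact K"
  obtains s :: "'b \<Rightarrow> real" and p :: "real \<Rightarrow> 'b"
  where "s \<in> borel_measurable borel" "\<And>x. s x \<in> {0..3/2}" "continuous_on UNIV p" "\<And>x. x \<in> K \<Longrightarrow> p (s x) = x"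
proof -
  obtain D :: "'b set" where D: "countable D" "\<And>X. open X \<Longrightarrow> X \<noteq> {} \<Longrightarrow> \<exists>d\<in>D. d \<in> X"
    by (rule countable_dense_setE) blast
  define BB where "BB = (\<lambda>(d, m). ball d (inverse (real (Suc m)))) ` (D \<times> (UNIV :: nat set))"
  have "countable BB" unfolding BB_def using D by auto
  moreover have "D \<noteq> {}" using D(2)[of UNIV] by auto
  then have "BB \<noteq> {}" by (auto simp: BB_def)
  ultimately have e: "range (from_nat_into BB) = BB"
    by (intro range_from_nat_into)
  define e where "e = from_nat_into BB"
  note e = e[folded e_def]
  have eo[measurable]: "e i \<in> sets borel" for i
  proof -
    have "e i \<in> BB" using e by auto
    then show ?thesis by (auto simp: BB_def)
  qed
  \<comment> \<open>Ternary expansions with digits 0 and 1 are separated by gaps, which makes the inverse of \<open>s\<close>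
    uniformly continuous.\<close>
  define s where "s x = (\<Sum>i. of_bool (x \<in> e i) * (1/3::real)^i)" for x
  have g: "summable (\<lambda>i. (1/3::real)^i)" by (simp add: summable_geometric)
  have sm: "summable (\<lambda>i. of_bool (x i) * (1/3::real)^i)" for x :: "nat \<Rightarrow> bool"
    by (rule summable_comparison_test'[OF g]) auto
  have s1: "s \<in> borel_measurable borel" unfolding s_def by (intro borel_measurable_suminf borel_measurable_times) auto
  have s2: "s x \<in> {0..3/2}" for x
  proof -
    have "s x \<le> (\<Sum>i. (1/3::real)^i)" unfolding s_def by (intro suminf_le sm g) auto
    also have "\<dots> = 3/2" by (subst suminf_geometric) auto
    finally show ?thesis unfolding s_def by (auto intro!: suminf_nonneg sm)
  qed
  have close: "\<exists>\<delta>>0. \<forall>x\<in>K. \<forall>y\<in>K. dist (s x) (s y) < \<delta> \<longrightarrow> dist x y < \<epsilon>" if "\<epsilon> > 0" for \<epsilon>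
  proof -
    obtain m where m: "inverse (real (Suc m)) < \<epsilon>/2" using reals_Archimedean[of "\<epsilon>/2"] \<open>\<epsilon> > 0\<close> by auto
    define r where "r = inverse (real (Suc m))"
    have r: "r > 0" by (simp add: r_def)
    have "K \<subseteq> (\<Union>d\<in>D. ball d r)"
    proof
      fix x assume "x \<in> K"
      obtain d where "d \<in> D" "d \<in> ball x r" using D(2)[of "ball x r"] r by auto
      then show "x \<in> (\<Union>d\<in>D. ball d r)" by (auto simp: dist_commute)
    qed
    then obtain D' where D': "D' \<subseteq> D" "finite D'" "K \<subseteq> (\<Union>d\<in>D'. ball d r)"
      using compactE_image[OF K, of D "\<lambda>d. ball d r"] by auto
    have "\<exists>i. e i = ball d r" if "d \<in> D'" for d
    proof -
      have "ball d r \<in> BB" using that D' by (auto simp: BB_def r_def)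
      then show ?thesis unfolding e[symmetric] by auto
    qed
    then obtain i where i: "\<And>d. d \<in> D' \<Longrightarrow> e (i d) = ball d r" by metis
    obtain n where n: "\<And>d. d \<in> D' \<Longrightarrow> i d \<le> n"
      using finite_nat_set_iff_bounded_le[of "i ` D'"] D'(2) by auto
    \<comment> \<open>Codes closer than (1/3)^n/2 agree in the digits 0 to \<open>n\<close>, among
      which are those of all balls of the finite subcover. The two points then share a ball of
      radius \<open>r\<close>, and 2 \<open>r\<close> is less than \<epsilon>.\<close>
    show ?thesis
    proof (intro exI[of _ "(1/3)^n/2"] conjI ballI impI)
      fix x y assume xy: "x \<in> K" "y \<in> K" "dist (s x) (s y) < (1/3)^n/2"
      have ag: "x \<in> e k \<longleftrightarrow> y \<in> e k" if "k \<le> n" for k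
        using base3_bits_gap[of k n "\<lambda>i. x \<in> e i" "\<lambda>i. y \<in> e i"] that xy(3)
        unfolding s_def dist_real_def by linarith
      obtain d where d: "d \<in> D'" "x \<in> ball d r" using D' xy by auto
      then have "y \<in> ball d r" using ag[OF n[OF d(1)]] i by auto
      then have "dist x y < r + r" using d dist_triangle_less_add[of x d r y r] by (auto simp: dist_commute)
      then show "dist x y < \<epsilon>" using m by (simp add: r_def)
    qed simp
  qed
  have inj: "inj_on s K"
  proof (rule inj_onI)
    fix x y assume xy: "x \<in> K" "y \<in> K" "s x = s y"
    show "x = y"
    proof (rule ccontr)
      assume "x \<noteq> y"
      then obtain \<delta> where "\<delta> > 0" "\<forall>x'\<in>K. \<forall>y'\<in>K. dist (s x') (s y') < \<delta> \<longrightarrow> dist x' y' < dist x y"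
        using close[of "dist x y"] by auto
      then show False using xy by fastforce
    qed
  qed
  have "uniformly_continuous_on (s ` K) (inv_into K s)"
    unfolding uniformly_continuous_on_def
  proof (intro allI impI)
    fix \<epsilon> :: real assume "\<epsilon> > 0"
    from close[OF this] obtain \<delta> where "\<delta> > 0" "\<forall>x\<in>K. \<forall>y\<in>K. dist (s x) (s y) < \<delta> \<longrightarrow> dist x y < \<epsilon>" by auto
    then show "\<exists>d>0. \<forall>x\<in>s ` K. \<forall>x'\<in>s ` K. dist x' x < d \<longrightarrow> dist (inv_into K s x') (inv_into K s x) < \<epsilon>"
      using inj by (auto intro!: exI[of _ \<delta>])
  qed
  then obtain g where g: "uniformly_continuous_on (closure (s ` K)) g" "\<And>x. x \<in> s ` K \<Longrightarrow> inv_into K s x = g x"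
    by (rule uniformly_continuous_on_extension_on_closure) blast
  obtain p where p: "continuous_on UNIV p" "\<And>x. x \<in> closure (s ` K) \<Longrightarrow> p x = g x"
    using Tietze_unbounded[of "closure (s ` K)" g UNIV] uniformly_continuous_imp_continuous[OF g(1)] by auto
  have "p (s x) = x" if "x \<in> K" for x
    using p(2)[of "s x"] g(2)[of "s x"] that inj closure_subset[of "s ` K"] by auto
  with s1 s2 p(1) show thesis by (rule that)
qed

section \<open>Weak sequential compactness\<close>

text \<open>The images under the code \<open>s\<close> live on a bounded interval, where tightness
  is automatic and Helly's theorem applies; the limit is brought back by \<open>p\<close>. That
  \<open>s\<close> may jump does no harm: on \<open>K\<close> a test function \<open>f\<close>
  equals \<open>f (p (s x))\<close>, so on the line only the continuous function \<open>f\<close>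
  after \<open>p\<close> is tested.\<close>

lemma compact_prob_measures_convergent_subsequence:
  fixes K :: "'b::euclidean_space set" and P :: "nat \<Rightarrow> 'b measure"
  assumes K: "compact K"
    and prob: "\<And>n. prob_space (P n)" and sets_P: "\<And>n. sets (P n) = sets borel"
    and AE_K: "\<And>n. AE x in P n. x \<in> K"
  obtains r :: "nat \<Rightarrow> nat" and Q where "strict_mono r" "prob_space Q" "sets Q = sets borel" "AE x in Q. x \<in> K"
    "\<And>(f :: 'b \<Rightarrow> real) C. continuous_on UNIV f \<Longrightarrow> (\<And>x. \<bar>f x\<bar> \<le> C) \<Longrightarrow>
      (\<lambda>n. \<integral>x. f x \<partial>P (r n)) \<longlonglongrightarrow> (\<integral>x. f x \<partial>Q)"
proof -
  obtain s :: "'b \<Rightarrow> real" and p where s[measurable]: "s \<in> borel_measurable borel" and s01: "\<And>x. s x \<in> {0..3/2}"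
    and p: "continuous_on UNIV p" and ps: "\<And>x. x \<in> K \<Longrightarrow> p (s x) = x"
    by (rule compact_real_coding[OF K]) blast
  have pm[measurable]: "p \<in> borel_measurable borel" using p by (rule borel_measurable_continuous_onI)
  note [measurable_cong] = sets_P
  define M where "M n = distr (P n) borel s" for n
  have M: "real_distribution (M n)" for n
  proof -
    interpret prob_space "P n" by (rule prob)
    show ?thesis unfolding M_def by (rule real_distribution_distr) measurable
  qed
  have "tight M" unfolding tight_def
  proof (intro conjI allI impI M)
    fix e :: real assume e: "e > 0"
    \<comment> \<open>All codes lie in [0, 3/2], so this half-open interval carries the full mass
      for every \<open>n\<close>.\<close>
    have "measure (M n) {-1<..2} > 1 - e" for n
    proof -
    interpret prob_space "P n" by (rule prob)
    have "measure (M n) {-1<..2} = prob (s -` {-1<..2} \<inter> space (P n))"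
      unfolding M_def by (rule measure_distr) (auto simp: measurable_cong_sets[OF sets_P refl])
    also have "s -` {-1<..2} \<inter> space (P n) = space (P n)"
    proof -
      have "s x \<in> {-1<..2}" for x using s01[of x] by auto
      then show ?thesis by auto
    qed
    finally show ?thesis using e by (simp add: prob_space)
    qed
    then show "\<exists>a b. a < b \<and> (\<forall>n. measure (M n) {a<..b} > 1 - e)"
      by (intro exI[of _ "-1"] exI[of _ 2]) auto
  qed
  from tight_imp_convergent_subsubsequence[OF this, of id] obtain r N
    where r: "strict_mono r" and N: "real_distribution N" and wc: "weak_conv_m (M \<circ> r) N"
    by (auto simp: strict_mono_id)
  interpret N: real_distribution N by fact
  define Q where "Q = distr N borel p"
  have Q: "prob_space Q" "sets Q = sets borel"
    unfolding Q_def by (auto intro!: N.prob_space_distr)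
  have lim: "(\<lambda>n. \<integral>x. f x \<partial>P (r n)) \<longlonglongrightarrow> (\<integral>x. f x \<partial>Q)"
    if f: "continuous_on UNIV f" and C: "\<And>x. \<bar>f x\<bar> \<le> C" for f :: "'b \<Rightarrow> real" and C
  proof -
    have [measurable]: "f \<in> borel_measurable borel" using f by (rule borel_measurable_continuous_onI)
    have fp: "continuous_on UNIV (\<lambda>t. f (p t))"
      by (rule continuous_on_compose2[OF f p]) auto
    have "(\<lambda>n. integral\<^sup>L ((M \<circ> r) n) (\<lambda>t. f (p t))) \<longlonglongrightarrow> integral\<^sup>L N (\<lambda>t. f (p t))"
      by (rule weak_conv_imp_integral_bdd_continuous_conv[where B=C])
         (use M N wc C fp in \<open>auto simp: continuous_on_eq_continuous_at comp_def\<close>)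
    moreover have "integral\<^sup>L ((M \<circ> r) n) (\<lambda>t. f (p t)) = (\<integral>x. f x \<partial>P (r n))" for n
    proof -
      have "integral\<^sup>L ((M \<circ> r) n) (\<lambda>t. f (p t)) = (\<integral>x. f (p (s x)) \<partial>P (r n))"
        unfolding M_def comp_def by (subst integral_distr) (auto simp: measurable_cong_sets[OF sets_P refl])
      also have "\<dots> = (\<integral>x. f x \<partial>P (r n))"
        by (rule integral_cong_AE) (use AE_K[of "r n"] ps in auto)
      finally show ?thesis .
    qed
    ultimately show ?thesis unfolding Q_def by (subst integral_distr) auto
  qed
  interpret Q: prob_space Q by fact
  \<comment> \<open>By convention \<open>infdist\<close> to the empty set is 0, so the zero set of
    the function \<open>g\<close> below is \<open>K\<close> only when \<open>K\<close> is
    nonempty.\<close>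
  have neK: "K \<noteq> {}"
  proof
    assume "K = {}"
    interpret prob_space "P 0" by (rule prob)
    show False using AE_K[of 0] \<open>K = {}\<close> by simp
  qed
  \<comment> \<open>A bounded continuous function that vanishes exactly on the closed set
    \<open>K\<close>. Its integrals along the sequence are 0, hence so is the limit integral, which
    forces \<open>Q\<close> onto \<open>K\<close>.\<close>
  define g where "g x = min 1 (infdist x K)" for x
  have gc: "continuous_on UNIV g" unfolding g_def by (intro continuous_intros)
  have g1: "\<bar>g x\<bar> \<le> 1" "g x \<ge> 0" for x unfolding g_def using infdist_nonneg[of x K] by auto
  have gm[measurable]: "g \<in> borel_measurable borel" using gc by (rule borel_measurable_continuous_onI)
  have "(\<integral>x. g x \<partial>P (r n)) = 0" for n
    by (rule integral_eq_zero_AE) (use AE_K[of "r n"] in \<open>auto simp: g_def elim!: eventually_mono\<close>)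
  with lim[OF gc g1(1)] have "(\<integral>x. g x \<partial>Q) = 0" using LIMSEQ_unique[OF _ tendsto_const] by auto
  moreover have "integrable Q g" by (rule Q.integrable_const_bound[of _ 1]) (use g1 Q in auto)
  ultimately have "AE x in Q. g x = 0" using integral_nonneg_eq_0_iff_AE[of Q g] g1 by auto
  then have "AE x in Q. x \<in> K"
  proof (eventually_elim)
    fix x assume "g x = 0"
    then have "infdist x K = 0" unfolding g_def by (auto simp: min_def split: if_splits)
    then show "x \<in> K" using in_closed_iff_infdist_zero[OF compact_imp_closed[OF K] neK] by auto
  qed
  then show thesis using that r Q lim by blast
qed

section \<open>Disintegration\<close>

text \<open>Uniqueness of densities is applied to \<open>g\<close> and \<open>max f g\<close>. Their
  integrals over \<open>A\<close> agree after splitting \<open>A\<close> along the set where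
  \<open>g < f\<close>. This way no integrals, possibly infinite, have to be subtracted.\<close>

lemma AE_le_of_nn_integral_le:
  fixes f g :: "'a \<Rightarrow> ennreal"
  assumes "finite_measure M" and [measurable]: "f \<in> borel_measurable M" "g \<in> borel_measurable M"
    and le: "\<And>A. A \<in> sets M \<Longrightarrow> (\<integral>\<^sup>+x. f x * indicator A x \<partial>M) \<le> (\<integral>\<^sup>+x. g x * indicator A x \<partial>M)"
  shows "AE x in M. f x \<le> g x"
proof -
  interpret finite_measure M by fact
  have "AE x in M. g x = max (f x) (g x)"
  proof (rule density_unique_finite_measure)
    fix A assume A[measurable]: "A \<in> sets M"
    define S where "S = {x\<in>space M. g x < f x}"
    have S[measurable]: "S \<in> sets M" unfolding S_def by measurable
    have "(\<integral>\<^sup>+x. max (f x) (g x) * indicator A x \<partial>M) =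
        (\<integral>\<^sup>+x. f x * indicator (A \<inter> S) x + g x * indicator (A - S) x \<partial>M)"
      by (rule nn_integral_cong) (auto simp: S_def indicator_def max_def)
    also have "\<dots> = (\<integral>\<^sup>+x. f x * indicator (A \<inter> S) x \<partial>M) + (\<integral>\<^sup>+x. g x * indicator (A - S) x \<partial>M)"
      by (rule nn_integral_add) measurable
    also have "\<dots> \<le> (\<integral>\<^sup>+x. g x * indicator (A \<inter> S) x \<partial>M) + (\<integral>\<^sup>+x. g x * indicator (A - S) x \<partial>M)"
      by (intro add_mono le) auto
    also have "\<dots> = (\<integral>\<^sup>+x. g x * indicator (A \<inter> S) x + g x * indicator (A - S) x \<partial>M)"
      by (rule nn_integral_add[symmetric]) measurable
    also have "\<dots> = (\<integral>\<^sup>+x. g x * indicator A x \<partial>M)"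
      by (rule nn_integral_cong) (auto simp: indicator_def)
    finally have "(\<integral>\<^sup>+x. max (f x) (g x) * indicator A x \<partial>M) \<le> (\<integral>\<^sup>+x. g x * indicator A x \<partial>M)" .
    moreover have "(\<integral>\<^sup>+x. g x * indicator A x \<partial>M) \<le> (\<integral>\<^sup>+x. max (f x) (g x) * indicator A x \<partial>M)"
      by (intro nn_integral_mono mult_right_mono) auto
    ultimately show "(\<integral>\<^sup>+x. g x * indicator A x \<partial>M) = (\<integral>\<^sup>+x. max (f x) (g x) * indicator A x \<partial>M)"
      by (rule antisym[rotated])
  qed auto
  then show ?thesis by eventually_elim (metis max.cobounded1)
qed

text \<open>For fixed \<open>q\<close>, \<open>g x\<close> is the conditional probability of the
  event \<open>snd z \<le> q\<close> given \<open>fst z = x\<close>: a Radon-Nikodym density with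
  respect to the first marginal. For \<open>q\<close> outside [a, b) the values 0 and 1 are imposed
  at every \<open>x\<close>, which later yields the limits at both infinities without exceptional
  points.\<close>

lemma conditional_cdf_exists:
  fixes N :: "('a::euclidean_space \<times> real) measure"
  assumes N: "prob_space N" and sets_N: "sets N = sets borel" and ab: "AE z in N. snd z \<in> {a..b}"
  obtains g where "g \<in> borel_measurable borel" "\<And>x. g x \<le> (1::ennreal)"
    "q < a \<Longrightarrow> g = (\<lambda>x. 0)" "b \<le> q \<Longrightarrow> g = (\<lambda>x. 1)"
    "\<And>B. B \<in> sets borel \<Longrightarrow> (\<integral>\<^sup>+x. g x * indicator B x \<partial>distr N borel fst) = emeasure N (B \<times> {..q})"
proof -
  interpret N: prob_space N by fact
  note [measurable_cong] = sets_N
  have fst[measurable]: "fst \<in> measurable N borel" by (simp add: measurable_cong_sets[OF sets_N refl] flip: borel_prod)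
  have rect[measurable]: "B \<times> C \<in> sets N" if "B \<in> sets borel" "C \<in> sets borel" for B :: "'a set" and C
    unfolding sets_N using that by (simp flip: borel_prod)
  have spN: "space N = UNIV" using sets_eq_imp_space_eq[OF sets_N] by simp
  define \<pi> where "\<pi> = distr N borel fst"
  interpret \<pi>: prob_space \<pi> unfolding \<pi>_def by (rule N.prob_space_distr) (rule fst)
  have s\<pi>: "sets \<pi> = sets borel" by (simp add: \<pi>_def)
  note [measurable_cong] = s\<pi>
  have e\<pi>: "emeasure \<pi> B = emeasure N (B \<times> UNIV)" if "B \<in> sets borel" for B
    unfolding \<pi>_def using that by (subst emeasure_distr) (auto simp: spN intro!: arg_cong[where f="emeasure N"])
  consider "q < a" | "\<not> q < a" "b \<le> q" | "\<not> q < a" "\<not> b \<le> q" by blast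
  then show thesis
  proof cases
    case 1
    have "emeasure N (B \<times> {..q}) = 0" if "B \<in> sets borel" for B
    proof -
      have "AE x in N. x \<notin> B \<times> {..q}" using ab by eventually_elim (use 1 in auto)
      then show ?thesis using AE_iff_null_sets[OF rect[OF that, of "{..q}"]] by (auto simp: null_sets_def)
    qed
    \<comment> \<open>The two prescribed values cannot clash: with \<open>b \<le> q < a\<close> the
      interval {a..b} would be empty, which a probability measure excludes.\<close>
    have "b \<le> q \<Longrightarrow> (\<lambda>x::'a. 0) = (\<lambda>x. 1::ennreal)"
    proof -
      assume "b \<le> q"
      then have "{a..b} = {}" using 1 by simp
      then show ?thesis using ab by simp
    qed
    with 1 \<open>\<And>B. B \<in> sets borel \<Longrightarrow> emeasure N (B \<times> {..q}) = 0\<close> show ?thesis by (intro that[of "\<lambda>_. 0"]) auto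
  next
    case 2
    have "emeasure N (B \<times> {..q}) = emeasure \<pi> B" if "B \<in> sets borel" for B
      unfolding e\<pi>[OF that]
    proof (rule emeasure_eq_AE)
      show "AE x in N. (x \<in> B \<times> {..q}) = (x \<in> B \<times> UNIV)" using ab by eventually_elim (use 2 in auto)
    qed (use that in auto)
    with 2 show ?thesis by (intro that[of "\<lambda>_. 1"]) (auto simp flip: \<pi>_def simp: s\<pi>)
  next
    case 3
    define \<nu> where "\<nu> = distr (density N (indicator (UNIV \<times> {..q}))) borel fst"
    have e\<nu>: "emeasure \<nu> B = emeasure N (B \<times> {..q})" if [measurable]: "B \<in> sets borel" for B
    proof -
      have "emeasure \<nu> B = emeasure (density N (indicator (UNIV \<times> {..q}))) (B \<times> UNIV)"
        unfolding \<nu>_def by (subst emeasure_distr) (auto simp: spN intro!: arg_cong[where f="emeasure _"])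
      also have "\<dots> = (\<integral>\<^sup>+z. indicator (UNIV \<times> {..q}) z * indicator (B \<times> UNIV) z \<partial>N)"
        by (rule emeasure_density) auto
      also have "\<dots> = (\<integral>\<^sup>+z. indicator (B \<times> {..q}) z \<partial>N)"
        by (rule nn_integral_cong) (auto simp: indicator_def)
      also have "\<dots> = emeasure N (B \<times> {..q})" by simp
      finally show ?thesis .
    qed
    have s\<nu>: "sets \<nu> = sets borel" by (simp add: \<nu>_def)
    have le: "emeasure \<nu> B \<le> emeasure \<pi> B" if "B \<in> sets borel" for B
      unfolding e\<nu>[OF that] e\<pi>[OF that] using that by (intro emeasure_mono) auto
    have "finite_measure \<nu>"
    proof
      have "emeasure \<nu> UNIV \<le> emeasure \<pi> (space \<pi>)" using le[of UNIV] sets_eq_imp_space_eq[OF s\<pi>] by simp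
      then show "emeasure \<nu> (space \<nu>) \<noteq> \<infinity>" using sets_eq_imp_space_eq[OF s\<nu>] \<pi>.emeasure_space_1
        by (auto simp: top_unique)
    qed
    moreover have "absolutely_continuous \<pi> \<nu>"
      unfolding absolutely_continuous_def using le by (force simp: null_sets_def s\<pi> s\<nu>)
    ultimately obtain f where f[measurable]: "f \<in> borel_measurable \<pi>" and d: "density \<pi> f = \<nu>"
      using \<pi>.Radon_Nikodym_finite_measure[of \<nu>] by (auto simp: s\<pi> s\<nu>)
    have fB: "(\<integral>\<^sup>+x. f x * indicator B x \<partial>\<pi>) = emeasure \<nu> B" if "B \<in> sets borel" for B
      unfolding d[symmetric] using that by (subst emeasure_density) (auto simp: s\<pi>)
    \<comment> \<open>Since \<nu> is dominated by \<pi>, its density is at most 1 almost everywhere.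
      Truncating with \<open>min 1\<close> makes the bound hold everywhere and changes no
      integral.\<close>
    have "AE x in \<pi>. f x \<le> 1"
      by (rule AE_le_of_nn_integral_le) (use le fB in \<open>auto simp: \<pi>.finite_measure_axioms s\<pi>\<close>)
    then have "(\<integral>\<^sup>+x. min 1 (f x) * indicator B x \<partial>\<pi>) = emeasure N (B \<times> {..q})" if "B \<in> sets borel" for B
      unfolding e\<nu>[OF that, symmetric] fB[OF that, symmetric]
      by (intro nn_integral_cong_AE) (auto simp: min_def elim!: eventually_mono)
    then show ?thesis using 3 f by (intro that[of "\<lambda>x. min 1 (f x)"]) (auto simp flip: \<pi>_def simp: s\<pi> cong: measurable_cong_sets)
  qed
qed

text \<open>The conditional probabilities for the separate thresholds are regularised to a true
  distribution function at every \<open>x\<close>, and \<open>interval_measure\<close> turns these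
  into a kernel. The two joint measures are then compared on the sets
  \<open>B \<times> {..t}\<close>, which generate the Borel sets and are closed under
  intersection.\<close>

lemma disintegration_real:
  fixes N :: "('a::euclidean_space \<times> real) measure"
  assumes N: "prob_space N" and sets_N: "sets N = sets borel" and ab: "AE z in N. snd z \<in> {a..b}"
  obtains \<kappa> where "\<kappa> \<in> borel \<rightarrow>\<^sub>M prob_algebra borel"
    "N = distr N borel fst \<bind> (\<lambda>x. distr (\<kappa> x) borel (Pair x))"
proof -
  interpret N: prob_space N by fact
  note [measurable_cong] = sets_N
  have fst[measurable]: "fst \<in> measurable N borel" by (simp add: measurable_cong_sets[OF sets_N refl] flip: borel_prod)
  have rect[measurable]: "B \<times> C \<in> sets N" if "B \<in> sets borel" "C \<in> sets borel" for B :: "'a set" and C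
    unfolding sets_N using that by (simp flip: borel_prod)
  define \<pi> where "\<pi> = distr N borel fst"
  interpret \<pi>: prob_space \<pi> unfolding \<pi>_def by (rule N.prob_space_distr) (rule fst)
  have s\<pi>: "sets \<pi> = sets borel" by (simp add: \<pi>_def)
  note [measurable_cong] = s\<pi>
  have "\<exists>g. g \<in> borel_measurable borel \<and> (\<forall>x. g x \<le> (1::ennreal)) \<and>
    (q < a \<longrightarrow> g = (\<lambda>x. 0)) \<and> (b \<le> q \<longrightarrow> g = (\<lambda>x. 1)) \<and>
    (\<forall>B\<in>sets borel. (\<integral>\<^sup>+x. g x * indicator B x \<partial>\<pi>) = emeasure N (B \<times> {..q}))" for q
    unfolding \<pi>_def by (rule conditional_cdf_exists[OF N sets_N ab, of q]) blast
  \<comment> \<open>A function is chosen for every real \<open>q\<close>, not just for the rational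
    ones: \<open>g t\<close> with real \<open>t\<close> is needed in the lower bound of
    \<open>key\<close>.\<close>
  then obtain g where g[measurable]: "\<And>q. g q \<in> borel_measurable borel" and g1: "\<And>q x. g q x \<le> (1::ennreal)"
    and g0: "\<And>q x. q < a \<Longrightarrow> g q x = 0" and gb: "\<And>q x. b \<le> q \<Longrightarrow> g q x = 1"
    and gB: "\<And>q B. B \<in> sets borel \<Longrightarrow> (\<integral>\<^sup>+x. g q x * indicator B x \<partial>\<pi>) = emeasure N (B \<times> {..q})"
    unfolding fun_eq_iff by (metis (no_types))
  \<comment> \<open>The infimum over rationals \<open>q > t\<close> is monotone and right-continuous in \<open>t\<close> at every \<open>x\<close>,
    so no exceptional null set of points \<open>x\<close> has to be removed.\<close>
  define Qs where "Qs t = {q\<in>\<rat>. (t::real) < q}" for t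
  have Qs_c: "countable (Qs t)" for t unfolding Qs_def using countable_rat by (rule countable_subset[rotated]) auto
  have Qs_ex: "\<exists>q\<in>Qs t. q < u" if "t < u" for t u
    using Rats_dense_in_real[OF that] by (auto simp: Qs_def)
  define F where "F x t = (INF q\<in>Qs t. g q x)" for x t
  have F_le: "F x t \<le> g q x" if "q \<in> Qs t" for x t q unfolding F_def using that by (rule INF_lower)
  have F1: "F x t \<le> 1" for x t using Qs_ex[of t "t+1"] F_le g1 by (meson less_add_one order_trans)
  have Fm[measurable]: "(\<lambda>x. F x t) \<in> borel_measurable borel" for t
    unfolding F_def using Qs_c by measurable
  define f where "f x t = enn2real (F x t)" for x t
  have fF: "ennreal (f x t) = F x t" for x t
    unfolding f_def using F1[of x t] by (intro ennreal_enn2real) (auto simp: less_top[symmetric] top_unique)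
  have fnn: "0 \<le> f x t" for x t by (simp add: f_def)
  have Fmono: "F x t \<le> F x u" if "t \<le> u" for x t u
    unfolding F_def using that by (intro INF_superset_mono) (auto simp: Qs_def)
  have fmono: "f x t \<le> f x u" if "t \<le> u" for x t u
    unfolding f_def using Fmono[OF that] F1[of x u] by (intro enn2real_mono) (auto simp: less_top[symmetric] top_unique)
  have fright: "continuous (at_right t) (f x)" for x t
    unfolding continuous_within
  proof (rule order_tendstoI)
    fix y assume y: "y < f x t"
    show "\<forall>\<^sub>F u in at_right t. y < f x u"
      using eventually_at_right_less[of t] by eventually_elim (rule less_le_trans[OF y fmono], simp)
  next
    fix y assume y: "f x t < y"
    then have "F x t < ennreal y" unfolding fF[symmetric]
      using fnn[of x t] by (intro ennreal_lessI) auto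
    then obtain q where q: "q \<in> Qs t" "g q x < ennreal y" unfolding F_def by (auto simp: INF_less_iff)
    have "f x u < y" if "t < u" "u < q" for u
    proof -
      have "F x u \<le> g q x" using q that by (intro F_le) (auto simp: Qs_def)
      then have "ennreal (f x u) < ennreal y" using q by (simp add: fF)
      then show ?thesis using ennreal_less_iff[OF fnn] by blast
    qed
    moreover have "t < q" using q by (simp add: Qs_def)
    ultimately show "\<forall>\<^sub>F u in at_right t. f x u < y" unfolding eventually_at_right_field
      by (intro exI[of _ q]) simp
  qed
  \<comment> \<open>The exact values of \<open>g\<close> outside [a, b) make \<open>f x\<close>
    constant near both infinities.\<close>
  have fbot: "f x t = 0" if "t < a" for x t
  proof -
    obtain q where "q \<in> Qs t" "q < a" using Qs_ex[OF \<open>t < a\<close>] by blast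
    then have "F x t \<le> 0" using F_le[of q t x] g0[of q x] by simp
    then show ?thesis by (simp add: f_def)
  qed
  have ftop: "f x t = 1" if "b < t" for x t
  proof -
    have "F x t = (INF q\<in>Qs t. 1)" unfolding F_def using that by (intro INF_cong) (auto simp: Qs_def gb)
    also have "\<dots> = 1" using Qs_ex[of t "t+1"] by (intro INF_const) auto
    finally show ?thesis by (simp add: f_def)
  qed
  have lbot: "(f x \<longlongrightarrow> 0) at_bot" for x
    by (rule tendsto_eventually) (auto simp: eventually_at_bot_dense fbot intro!: exI[of _ a])
  have ltop: "(f x \<longlongrightarrow> 1) at_top" for x
    by (rule tendsto_eventually) (auto simp: eventually_at_top_dense ftop intro!: exI[of _ b])
  define \<kappa> where "\<kappa> x = interval_measure (f x)" for x
  have rd: "real_distribution (\<kappa> x)" for x unfolding \<kappa>_def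
    by (rule real_distribution_interval_measure[OF fmono fright lbot ltop])
  have k_prob: "prob_space (\<kappa> x)" and k_sets: "sets (\<kappa> x) = sets borel" for x
    using rd[of x] by (auto simp: real_distribution_def real_distribution_axioms_def)
  have ek: "emeasure (\<kappa> x) {..t} = F x t" for x t unfolding \<kappa>_def
    by (subst emeasure_interval_measure_Iic[OF fmono fright lbot]) (auto simp: fF)
  have bor: "sets borel = sigma_sets UNIV (range (atMost :: real \<Rightarrow> _))"
    by (subst borel_eq_atMost) simp
  have \<kappa>[measurable]: "\<kappa> \<in> borel \<rightarrow>\<^sub>M prob_algebra borel"
  proof (rule measurable_prob_algebra_generated[OF bor])
    show "Int_stable (range (atMost :: real \<Rightarrow> _))" by (auto simp: Int_stable_def)
    show "(\<lambda>x. emeasure (\<kappa> x) A) \<in> borel_measurable borel" if "A \<in> range atMost" for A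
      using that by (auto simp: ek)
  qed (auto simp: k_prob k_sets)
  have key: "(\<integral>\<^sup>+x. F x t * indicator B x \<partial>\<pi>) = emeasure N (B \<times> {..t})" if B[measurable]: "B \<in> sets borel" for B t
  proof (rule antisym)
    \<comment> \<open>Upper bound: a rational \<open>q\<close> slightly above \<open>t\<close>
      bounds \<open>F\<close>, and continuity of \<open>N\<close> from above then removes the
      slack.\<close>
    have le: "(\<integral>\<^sup>+x. F x t * indicator B x \<partial>\<pi>) \<le> emeasure N (B \<times> {..t + inverse (real (Suc n))})" for n
    proof -
      obtain q where q: "q \<in> Qs t" "q < t + inverse (real (Suc n))"
        using Qs_ex[of t "t + inverse (real (Suc n))"] by (auto simp: field_simps)
      have "(\<integral>\<^sup>+x. F x t * indicator B x \<partial>\<pi>) \<le> (\<integral>\<^sup>+x. g q x * indicator B x \<partial>\<pi>)"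
        by (intro nn_integral_mono mult_right_mono F_le q) auto
      also have "\<dots> = emeasure N (B \<times> {..q})" by (rule gB) fact
      also have "\<dots> \<le> emeasure N (B \<times> {..t + inverse (real (Suc n))})"
        using q by (intro emeasure_mono) auto
      finally show ?thesis .
    qed
    have "(\<lambda>n. emeasure N (B \<times> {..t + inverse (real (Suc n))})) \<longlonglongrightarrow> emeasure N (\<Inter>n. B \<times> {..t + inverse (real (Suc n))})"
    proof (rule Lim_emeasure_decseq)
      show "decseq (\<lambda>n. B \<times> {..t + inverse (real (Suc n))})"
      proof (rule decseq_SucI)
        fix n
        have "inverse (real (Suc (Suc n))) \<le> inverse (real (Suc n))" by (intro le_imp_inverse_le) auto
        then show "B \<times> {..t + inverse (real (Suc (Suc n)))} \<subseteq> B \<times> {..t + inverse (real (Suc n))}"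
          by (intro Sigma_mono order_refl atMost_subset_iff[THEN iffD2] add_left_mono)
      qed
    qed auto
    also have "(\<Inter>n. B \<times> {..t + inverse (real (Suc n))}) = B \<times> {..t}"
    proof (intro set_eqI iffI)
      fix z assume z: "z \<in> (\<Inter>n. B \<times> {..t + inverse (real (Suc n))})"
      have "snd z \<le> t"
      proof (rule field_le_epsilon)
        fix e :: real assume "e > 0"
        then obtain n where "inverse (real (Suc n)) < e" using reals_Archimedean by blast
        moreover have "snd z \<le> t + inverse (real (Suc n))" using z by (auto simp del: of_nat_Suc)
        ultimately show "snd z \<le> t + e" by linarith
      qed
      then show "z \<in> B \<times> {..t}" using z by (auto simp: mem_Times_iff)
    next
      fix z assume z: "z \<in> B \<times> {..t}"
      have "t \<le> t + inverse (real (Suc n))" for n by simp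
      with z show "z \<in> (\<Inter>n. B \<times> {..t + inverse (real (Suc n))})"
        by (fastforce simp: mem_Times_iff intro: order_trans)
    qed
    finally show "(\<integral>\<^sup>+x. F x t * indicator B x \<partial>\<pi>) \<le> emeasure N (B \<times> {..t})"
      by (rule LIMSEQ_le_const) (use le in blast)
    \<comment> \<open>Lower bound: for each rational \<open>q > t\<close>, comparing the integrals
      over all Borel sets gives \<open>g t \<le> g q\<close> almost everywhere. Countably many
      \<open>q\<close> share one null set, so \<open>g t\<close> lies below the infimum
      \<open>F\<close> almost everywhere.\<close>
    have "AE x in \<pi>. \<forall>q\<in>Qs t. g t x \<le> g q x"
    proof (rule AE_ball_countable[THEN iffD2, OF Qs_c], rule ballI)
      fix q assume q: "q \<in> Qs t"
      show "AE x in \<pi>. g t x \<le> g q x"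
      proof (rule AE_le_of_nn_integral_le)
        fix A assume "A \<in> sets \<pi>"
        then have [measurable]: "A \<in> sets borel" by (simp add: s\<pi>)
        show "(\<integral>\<^sup>+x. g t x * indicator A x \<partial>\<pi>) \<le> (\<integral>\<^sup>+x. g q x * indicator A x \<partial>\<pi>)"
          using q by (subst (1 2) gB) (auto simp: Qs_def intro!: emeasure_mono)
      qed (use g in \<open>auto simp: \<pi>.finite_measure_axioms cong: measurable_cong_sets\<close>)
    qed
    then have "AE x in \<pi>. g t x * indicator B x \<le> F x t * indicator B x"
      by eventually_elim (auto simp: F_def intro!: mult_right_mono INF_greatest)
    then have "(\<integral>\<^sup>+x. g t x * indicator B x \<partial>\<pi>) \<le> (\<integral>\<^sup>+x. F x t * indicator B x \<partial>\<pi>)"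
      by (rule nn_integral_mono_AE)
    then show "emeasure N (B \<times> {..t}) \<le> (\<integral>\<^sup>+x. F x t * indicator B x \<partial>\<pi>)" by (simp add: gB)
  qed
  \<comment> \<open>The product of the point mass at \<open>x\<close> with
    \<open>\<kappa> x\<close>; binding \<pi> with it produces the joint law with first marginal
    \<pi> and conditional laws \<kappa>.\<close>
  define J where "J x = distr (\<kappa> x) borel (Pair x)" for x
  have J[measurable]: "J \<in> borel \<rightarrow>\<^sub>M prob_algebra borel"
    unfolding J_def by (rule measurable_distr_prob_space2[OF \<kappa>]) (simp add: borel_prod)
  have \<pi>in: "\<pi> \<in> space (prob_algebra borel)" by (simp add: space_prob_algebra s\<pi> \<pi>.prob_space_axioms)
  have sJ: "sets (\<pi> \<bind> J) = sets borel"
    using \<pi>in J by (rule sets_bind')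
  have gen: "sets (borel :: ('a \<times> real) measure) = sigma_sets UNIV {A \<times> B | A B. A \<in> sets borel \<and> B \<in> range (atMost :: real \<Rightarrow> _)}"
  proof -
    have "sets (borel \<Otimes>\<^sub>M borel :: ('a \<times> real) measure) = sets (sigma (space (borel::'a measure) \<times> space (borel::real measure)) {A \<times> B | A B. A \<in> sets borel \<and> B \<in> range (atMost :: real \<Rightarrow> _)})"
    proof (rule sets_pair_eq[of _ _ "{UNIV}" _ _ "range (\<lambda>n::nat. {..real n})"])
      show "sets (borel :: 'a measure) = sigma_sets (space borel) (sets borel)"
        using sets.sigma_sets_eq[of "borel :: 'a measure"] by simp
      show "\<Union> (range (\<lambda>n::nat. {..real n})) = space borel" using real_arch_simple by auto
    qed (use bor in auto)
    also have "\<dots> = sigma_sets UNIV {A \<times> B | A B. A \<in> sets borel \<and> B \<in> range (atMost :: real \<Rightarrow> _)}"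
      by (simp add: sets_measure_of)
    finally show ?thesis unfolding borel_prod .
  qed
  have "N = \<pi> \<bind> J"
  proof (rule measure_eqI_generator_eq[where A="\<lambda>n::nat. UNIV \<times> {..real n}"])
    show "Int_stable {A \<times> B | A B. A \<in> sets (borel::'a measure) \<and> B \<in> range (atMost :: real \<Rightarrow> _)}"
    proof (rule Int_stableI)
      fix X Y assume "X \<in> {A \<times> B | A B. A \<in> sets (borel::'a measure) \<and> B \<in> range (atMost :: real \<Rightarrow> _)}"
        "Y \<in> {A \<times> B | A B. A \<in> sets (borel::'a measure) \<and> B \<in> range (atMost :: real \<Rightarrow> _)}"
      then obtain A t C u where "X = A \<times> {..t}" "Y = C \<times> {..u}" "A \<in> sets borel" "C \<in> sets borel" by auto
      then have "X \<inter> Y = (A \<inter> C) \<times> {..min t u}" "A \<inter> C \<in> sets borel" by auto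
      then show "X \<inter> Y \<in> {A \<times> B | A B. A \<in> sets (borel::'a measure) \<and> B \<in> range (atMost :: real \<Rightarrow> _)}" by blast
    qed
    fix X assume "X \<in> {A \<times> B | A B. A \<in> sets (borel::'a measure) \<and> B \<in> range (atMost :: real \<Rightarrow> _)}"
    then obtain B t where X: "X = B \<times> {..t}" and B[measurable]: "B \<in> sets borel" by auto
    have Xb: "B \<times> {..t} \<in> sets borel" using rect[OF B, of "{..t}"] sets_N by simp
    have "emeasure (\<pi> \<bind> J) X = (\<integral>\<^sup>+x. emeasure (J x) (B \<times> {..t}) \<partial>\<pi>)"
      unfolding X by (rule emeasure_bind_prob_algebra[OF \<pi>in J Xb])
    also have "\<dots> = (\<integral>\<^sup>+x. F x t * indicator B x \<partial>\<pi>)"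
    proof (rule nn_integral_cong)
      fix x
      have "emeasure (J x) (B \<times> {..t}) = emeasure (\<kappa> x) (Pair x -` (B \<times> {..t}) \<inter> space (\<kappa> x))"
        unfolding J_def by (rule emeasure_distr) (auto simp: Xb measurable_cong_sets[OF k_sets refl] borel_prod[symmetric])
      also have "Pair x -` (B \<times> {..t}) \<inter> space (\<kappa> x) = (if x \<in> B then {..t} else {})"
        using sets_eq_imp_space_eq[OF k_sets[of x]] by auto
      finally show "emeasure (J x) (B \<times> {..t}) = F x t * indicator B x" by (simp add: ek)
    qed
    also have "\<dots> = emeasure N X" by (simp add: key X)
    finally show "emeasure N X = emeasure (\<pi> \<bind> J) X" by simp
  next
    show "(\<Union>n::nat. UNIV \<times> {..real n}) = UNIV" using real_arch_simple by auto
    show "range (\<lambda>n::nat. UNIV \<times> {..real n}) \<subseteq> {A \<times> B | A B. A \<in> sets (borel::'a measure) \<and> B \<in> range atMost}"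
    proof (rule image_subsetI)
      fix n :: nat
      have "UNIV \<in> sets (borel::'a measure)" "{..real n} \<in> range atMost" by auto
      then show "UNIV \<times> {..real n} \<in> {A \<times> B | A B. A \<in> sets (borel::'a measure) \<and> B \<in> range atMost}" by blast
    qed
  qed (use gen sJ sets_N in auto)
  then show thesis unfolding \<pi>_def J_def by (rule that[OF \<kappa>])
qed

text \<open>The inner integral is the integral of \<open>f\<close> against the image of
  \<open>\<kappa> x\<close> under \<open>Pair x\<close>. That image depends measurably on
  \<open>x\<close>, and integrating a fixed Borel function is measurable in the measure. Sections
  that are not integrable contribute the default value 0.\<close>

lemma borel_measurable_kernel_integral:
  fixes f :: "'a::second_countable_topology \<times> 'b::second_countable_topology \<Rightarrow> real"
  assumes k: "\<kappa> \<in> borel \<rightarrow>\<^sub>M prob_algebra borel" and f: "f \<in> borel_measurable borel"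
  shows "(\<lambda>x. \<integral>y. f (x, y) \<partial>\<kappa> x) \<in> borel_measurable borel"
proof -
  have "(\<lambda>x. distr (\<kappa> x) borel (Pair x)) \<in> borel \<rightarrow>\<^sub>M subprob_algebra borel"
    by (rule measurable_prob_algebraD[OF measurable_distr_prob_space2[OF k]]) (simp add: borel_prod)
  then have "(\<lambda>x. integral\<^sup>L (distr (\<kappa> x) borel (Pair x)) f) \<in> borel_measurable borel"
    by (rule measurable_compose) (rule integral_measurable_subprob_algebra[OF f])
  moreover have "integral\<^sup>L (distr (\<kappa> x) borel (Pair x)) f = (\<integral>y. f (x, y) \<partial>\<kappa> x)" for x
  proof (rule integral_distr[OF _ f])
    have s: "sets (\<kappa> x) = sets borel" using measurable_space[OF k, of x] by (auto simp: space_prob_algebra)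
    show "Pair x \<in> \<kappa> x \<rightarrow>\<^sub>M borel"
      unfolding measurable_cong_sets[OF s refl] borel_prod[symmetric] by measurable
  qed
  ultimately show ?thesis by simp
qed

text \<open>The second coordinate is coded by \<open>s\<close>, disintegrated on the line, and the
  resulting kernel is decoded by \<open>p\<close>. This puts the kernel on \<open>K\<close> only for
  almost every \<open>x\<close>; a change on the exceptional set achieves it for every
  \<open>x\<close>.\<close>

lemma disintegration_compact:
  fixes N :: "('a::euclidean_space \<times> 'b::euclidean_space) measure"
  assumes N: "prob_space N" and sets_N: "sets N = sets borel"
    and K: "compact K" and AE_K: "AE z in N. snd z \<in> K"
  obtains \<kappa> where "\<kappa> \<in> borel \<rightarrow>\<^sub>M prob_algebra borel" "\<And>x. AE y in \<kappa> x. y \<in> K"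
    "\<And>(f :: 'a \<times> 'b \<Rightarrow> real) C. f \<in> borel_measurable borel \<Longrightarrow> (\<And>z. \<bar>f z\<bar> \<le> C) \<Longrightarrow>
      integral\<^sup>L N f = (\<integral>x. (\<integral>y. f (x, y) \<partial>\<kappa> x) \<partial>distr N borel fst)"
proof -
  interpret N: prob_space N by fact
  have fst: "fst \<in> measurable N borel"
    by (simp add: measurable_cong_sets[OF sets_N refl] flip: borel_prod)
  obtain s :: "'b \<Rightarrow> real" and p where s[measurable]: "s \<in> borel_measurable borel" and s01: "\<And>x. s x \<in> {0..3/2}"
    and p: "continuous_on UNIV p" and ps: "\<And>x. x \<in> K \<Longrightarrow> p (s x) = x"
    by (rule compact_real_coding[OF K]) blast
  have pm[measurable]: "p \<in> borel_measurable borel" using p by (rule borel_measurable_continuous_onI)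
  have Kb[measurable]: "K \<in> sets borel" using K by (simp add: borel_compact)
  define N1 where "N1 = distr N borel (\<lambda>z. (fst z, s (snd z)))"
  have cm: "(\<lambda>z. (fst z, s (snd z))) \<in> measurable N borel"
    unfolding measurable_cong_sets[OF sets_N refl] borel_prod[symmetric] by measurable
  have N1: "prob_space N1" "sets N1 = sets borel"
    unfolding N1_def using N.prob_space_distr[OF cm] by auto
  have N1ab: "AE z in N1. snd z \<in> {0..3/2}"
    unfolding N1_def using s01 by (subst AE_distr_iff[OF cm]) (auto simp flip: borel_prod)
  obtain \<kappa>1 where k1[measurable]: "\<kappa>1 \<in> borel \<rightarrow>\<^sub>M prob_algebra borel"
    and N1b: "N1 = distr N1 borel fst \<bind> (\<lambda>x. distr (\<kappa>1 x) borel (Pair x))"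
    by (rule disintegration_real[OF N1 N1ab])
  define \<pi> where "\<pi> = distr N borel fst"
  have \<pi>1: "distr N1 borel fst = \<pi>"
    unfolding N1_def \<pi>_def by (subst distr_distr[OF _ cm]) (auto simp: comp_def simp flip: borel_prod)
  interpret \<pi>: prob_space \<pi> unfolding \<pi>_def by (rule N.prob_space_distr[OF fst])
  have s\<pi>: "sets \<pi> = sets borel" by (simp add: \<pi>_def)
  note [measurable_cong] = s\<pi>
  define J where "J x = distr (\<kappa>1 x) borel (Pair x)" for x
  have J: "J \<in> borel \<rightarrow>\<^sub>M prob_algebra borel"
    unfolding J_def by (rule measurable_distr_prob_space2[OF k1]) (simp add: borel_prod)
  then have J': "J \<in> \<pi> \<rightarrow>\<^sub>M subprob_algebra borel"
    unfolding measurable_cong_sets[OF s\<pi> refl] by (rule measurable_prob_algebraD)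
  have N1J: "N1 = \<pi> \<bind> J" using N1b unfolding \<pi>1 J_def .
  have k1s: "sets (\<kappa>1 x) = sets borel" and k1p: "prob_space (\<kappa>1 x)" for x
    using measurable_space[OF k1, of x] by (auto simp: space_prob_algebra)
  have Pm: "Pair x \<in> measurable (\<kappa>1 x) borel" for x
    unfolding measurable_cong_sets[OF k1s refl] borel_prod[symmetric] by measurable
  define \<kappa>2 where "\<kappa>2 x = distr (\<kappa>1 x) borel p" for x
  have k2[measurable]: "\<kappa>2 \<in> borel \<rightarrow>\<^sub>M prob_algebra borel"
    unfolding \<kappa>2_def by measurable
  have k2p: "prob_space (\<kappa>2 x)" and k2s: "sets (\<kappa>2 x) = sets borel" for x
    using measurable_space[OF k2, of x] by (auto simp: space_prob_algebra)
  have pm1: "p \<in> measurable (\<kappa>1 x) borel" for x unfolding measurable_cong_sets[OF k1s refl] by (rule pm)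
  have AE2: "AE x in \<pi>. AE y in \<kappa>2 x. y \<in> K"
  proof -
    \<comment> \<open>Decoding undoes coding on \<open>K\<close>, so this event has full mass under
      the coded law; the disintegration hands it down to almost every fibre.\<close>
    have "AE z in N1. p (snd z) \<in> K"
      unfolding N1_def
    proof (subst AE_distr_iff[OF cm])
      show "{z \<in> space borel. p (snd z) \<in> K} \<in> sets (borel :: ('a \<times> real) measure)"
        unfolding borel_prod[symmetric] by measurable
      show "AE z in N. p (snd (fst z, s (snd z))) \<in> K"
        using AE_K by eventually_elim (simp add: ps)
    qed
    then have "AE x in \<pi>. AE z in J x. p (snd z) \<in> K"
      unfolding N1J by (subst (asm) AE_bind[OF J']) (auto simp flip: borel_prod)
    then show ?thesis
    proof eventually_elim
      fix x assume x: "AE z in J x. p (snd z) \<in> K"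
      have "AE t in \<kappa>1 x. p (snd (x, t)) \<in> K"
        using x unfolding J_def by (subst (asm) AE_distr_iff[OF Pm]) (auto simp flip: borel_prod)
      then show "AE y in \<kappa>2 x. y \<in> K"
        unfolding \<kappa>2_def by (subst AE_distr_iff[OF pm1]) auto
    qed
  qed
  have "K \<noteq> {}" using AE_K by auto
  then obtain k0 where k0: "k0 \<in> K" by auto
  \<comment> \<open>The condition is Borel in \<open>x\<close>, so the modified kernel stays
    measurable. It differs from \<open>\<kappa>2\<close> only on a null set of \<pi>, where a point
    mass in \<open>K\<close> takes over.\<close>
  define \<kappa> where "\<kappa> x = (if emeasure (\<kappa>2 x) K = 1 then \<kappa>2 x else return borel k0)" for x
  have k[measurable]: "\<kappa> \<in> borel \<rightarrow>\<^sub>M prob_algebra borel"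
  proof -
    have [measurable]: "\<kappa>2 \<in> borel \<rightarrow>\<^sub>M subprob_algebra borel" using k2 by (rule measurable_prob_algebraD)
    show ?thesis unfolding \<kappa>_def
      by (intro measurable_If k2 measurable_const) (auto simp: space_prob_algebra prob_space_return)
  qed
  have AE1: "emeasure (\<kappa>2 x) K = 1 \<longleftrightarrow> (AE y in \<kappa>2 x. y \<in> K)" for x
  proof -
    interpret prob_space "\<kappa>2 x" by (rule k2p)
    show ?thesis using AE_in_set_eq_1[of K] by (simp add: k2s emeasure_eq_measure)
  qed
  have kK: "AE y in \<kappa> x. y \<in> K" for x
  proof (cases "emeasure (\<kappa>2 x) K = 1")
    case True
    then have "\<kappa> x = \<kappa>2 x" by (simp add: \<kappa>_def)
    with True show ?thesis by (simp only: AE1)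
  next
    case False
    then have "\<kappa> x = return borel k0" by (simp add: \<kappa>_def)
    moreover have "AE y in return borel k0. y \<in> K" using k0 by (subst AE_return) auto
    ultimately show ?thesis by (simp only:)
  qed
  have "integral\<^sup>L N f = (\<integral>x. (\<integral>y. f (x, y) \<partial>\<kappa> x) \<partial>\<pi>)"
    if f[measurable]: "f \<in> borel_measurable borel" and C: "\<And>z. \<bar>f z\<bar> \<le> C" for f :: "'a \<times> 'b \<Rightarrow> real" and C
  proof -
    \<comment> \<open>This is \<open>f\<close> read through the decoding, a function on the coded
      space. Composed with the coding it equals \<open>f\<close> almost everywhere for
      \<open>N\<close>.\<close>
    define h where "h z = f (fst z, p (snd z))" for z
    have h: "h \<in> borel_measurable borel" unfolding h_def
      using f unfolding borel_prod[symmetric] by measurable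
    have fx: "(\<lambda>y. f (x, y)) \<in> borel_measurable borel" for x
      using f unfolding borel_prod[symmetric] by measurable
    have "integral\<^sup>L N f = (\<integral>z. h (fst z, s (snd z)) \<partial>N)"
    proof (rule integral_cong_AE)
      show "f \<in> borel_measurable N" using f by (simp add: measurable_cong_sets[OF sets_N refl])
      show "(\<lambda>z. h (fst z, s (snd z))) \<in> borel_measurable N" using measurable_compose[OF cm h] .
      show "AE z in N. f z = h (fst z, s (snd z))"
        using AE_K by eventually_elim (simp add: h_def ps)
    qed
    also have "\<dots> = integral\<^sup>L N1 h" unfolding N1_def by (rule integral_distr[OF cm h, symmetric])
    also have "\<dots> = (\<integral>x. integral\<^sup>L (J x) h \<partial>\<pi>)"
      unfolding N1J
    proof (rule integral_bind[where K=borel and B'=1 and B=C])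
      show "AE x in \<pi>. emeasure (J x) (space (J x)) \<le> ennreal 1"
        using measurable_space[OF J] by (auto simp: space_prob_algebra prob_space.emeasure_space_1)
    qed (use h J' \<pi>.finite_measure_axioms in \<open>auto simp: h_def C\<close>)
    also have "\<dots> = (\<integral>x. (\<integral>y. f (x, y) \<partial>\<kappa>2 x) \<partial>\<pi>)"
      unfolding J_def \<kappa>2_def by (simp add: integral_distr[OF Pm h] integral_distr[OF pm1 fx] h_def)
    also have "\<dots> = (\<integral>x. (\<integral>y. f (x, y) \<partial>\<kappa> x) \<partial>\<pi>)"
    proof (rule integral_cong_AE)
      show "(\<lambda>x. \<integral>y. f (x, y) \<partial>\<kappa>2 x) \<in> borel_measurable \<pi>" "(\<lambda>x. \<integral>y. f (x, y) \<partial>\<kappa> x) \<in> borel_measurable \<pi>"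
        using borel_measurable_kernel_integral[OF k2 f] borel_measurable_kernel_integral[OF k f]
        unfolding measurable_cong_sets[OF s\<pi> refl] .
      show "AE x in \<pi>. (\<integral>y. f (x, y) \<partial>\<kappa>2 x) = (\<integral>y. f (x, y) \<partial>\<kappa> x)"
        using AE2
      proof eventually_elim
        case (elim x)
        then have "\<kappa> x = \<kappa>2 x" unfolding \<kappa>_def AE1 by (rule if_P)
        then show ?case by (simp only:)
      qed
    qed
    finally show ?thesis .
  qed
  with k kK show thesis unfolding \<pi>_def by (rule that)
qed

section \<open>The pair of limit measures\<close>

lemma continuous_on_compact_bounded_extension:
  fixes f :: "'a::euclidean_space \<Rightarrow> real"
  assumes S: "compact S" and f: "continuous_on S f"
  obtains g B where "continuous_on UNIV g" "\<And>x. \<bar>g x\<bar> \<le> B" "\<And>x. x \<in> S \<Longrightarrow> g x = f x"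
proof -
  have "bounded (f ` S)" using compact_continuous_image[OF f S] by (rule compact_imp_bounded)
  then obtain B where B: "B > 0" "\<And>x. x \<in> S \<Longrightarrow> norm (f x) \<le> B" unfolding bounded_pos by auto
  obtain g where g: "continuous_on UNIV g" "\<And>x. x \<in> S \<Longrightarrow> g x = f x" "\<And>x. x \<in> UNIV \<Longrightarrow> norm (g x) \<le> B"
    using Tietze[OF f, of UNIV B] B S by (auto simp: compact_imp_closed)
  show thesis by (rule that[of g B]) (use g in auto)
qed

text \<open>\<open>P\<close> is the normalised push-forward of \<open>w dM\<close>. If \<open>w\<close> has zero mass, it is an arbitrary
  point mass, which the factor in front of the integral makes irrelevant.\<close>

lemma weighted_pushforward:
  fixes w :: "'a \<Rightarrow> real" and T :: "'a \<Rightarrow> 'b::euclidean_space"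
  assumes w: "integrable M w" "\<And>x. 0 \<le> w x" and T[measurable]: "T \<in> M \<rightarrow>\<^sub>M borel"
    and K: "closed K" "k \<in> K" and TK: "AE x in M. T x \<in> K"
  obtains P where "prob_space P" "sets P = sets borel" "AE z in P. z \<in> K"
    "\<And>H::'b \<Rightarrow> real. H \<in> borel_measurable borel \<Longrightarrow> (\<integral>x. w x \<partial>M) * (\<integral>z. H z \<partial>P) = (\<integral>x. H (T x) * w x \<partial>M)"
proof (cases "(\<integral>x. w x \<partial>M) > 0")
  case True
  define m where "m = (\<integral>x. w x \<partial>M)"
  have m: "m > 0" using True by (simp add: m_def)
  have wm[measurable]: "w \<in> borel_measurable M" using w by auto
  define D where "D = density M (\<lambda>x. ennreal (w x / m))"
  have "emeasure D (space D) = (\<integral>\<^sup>+x. ennreal (w x / m) \<partial>M)"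
    unfolding D_def by (subst emeasure_density) (auto intro!: nn_integral_cong)
  also have "\<dots> = ennreal (\<integral>x. w x / m \<partial>M)"
    using w m by (intro nn_integral_eq_integral) auto
  also have "\<dots> = 1" using m by (simp add: m_def)
  finally interpret D: prob_space D by (rule prob_spaceI)
  have TD[measurable]: "T \<in> D \<rightarrow>\<^sub>M borel" by (simp add: D_def)
  show ?thesis
  proof (rule that[of "distr D borel T"])
    show "prob_space (distr D borel T)" by (rule D.prob_space_distr[OF TD])
    have [measurable]: "K \<in> sets borel" using K by auto
    have "AE x in D. T x \<in> K" unfolding D_def by (subst AE_density) (use TK in \<open>auto elim!: eventually_mono\<close>)
    then show "AE z in distr D borel T. z \<in> K" by (subst AE_distr_iff[OF TD]) auto
    fix H :: "'b \<Rightarrow> real" assume H[measurable]: "H \<in> borel_measurable borel"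
    have "(\<integral>z. H z \<partial>distr D borel T) = (\<integral>x. H (T x) \<partial>D)" by (rule integral_distr[OF TD H])
    also have "\<dots> = (\<integral>x. (w x / m) *\<^sub>R H (T x) \<partial>M)"
      unfolding D_def by (rule integral_density) (use w m in auto)
    also have "\<dots> = (\<integral>x. H (T x) * w x / m \<partial>M)" by (simp add: mult.commute)
    also have "\<dots> = (\<integral>x. H (T x) * w x \<partial>M) / m" by simp
    finally show "(\<integral>x. w x \<partial>M) * (\<integral>z. H z \<partial>distr D borel T) = (\<integral>x. H (T x) * w x \<partial>M)"
      using m by (simp flip: m_def)
  qed simp
next
  case False
  have i0: "(\<integral>x. w x \<partial>M) = 0" using False w by (simp add: antisym integral_nonneg)
  then have "AE x in M. w x = 0" using integral_nonneg_eq_0_iff_AE[OF w(1)] w(2) by auto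
  then have z: "(\<integral>x. H (T x) * w x \<partial>M) = 0" for H :: "'b \<Rightarrow> real"
    by (intro integral_eq_zero_AE) (auto elim!: eventually_mono)
  show ?thesis
  proof (rule that[of "return borel k"])
    show "prob_space (return borel k)" by (rule prob_space_return) simp
    have [measurable]: "K \<in> sets borel" using K by auto
    show "AE z in return borel k. z \<in> K" using K by (subst AE_return) auto
  qed (use i0 z in auto)
qed

lemma prob_abs_integral_le:
  fixes f :: "'a \<Rightarrow> real"
  assumes M: "prob_space M" and m: "f \<in> borel_measurable M" and f: "\<And>x. \<bar>f x\<bar> \<le> B"
  shows "\<bar>\<integral>x. f x \<partial>M\<bar> \<le> B"
proof -
  interpret prob_space M by fact
  have i: "integrable M f" by (rule integrable_const_bound[of _ B]) (use m f in auto)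
  have "-B \<le> f y" "f y \<le> B" for y using f[of y] by (auto simp: abs_le_iff)
  then show ?thesis using integral_le_const[OF i, of B] integral_ge_const[OF i, of "-B"] by auto
qed

text \<open>The measure-theoretic core, for fields bounded in L^2. Since \<open>f\<close> and
  \<open>g\<close> enter additively, only the marginals of the limit on (x, A) and on (x, e) matter,
  and both are disintegrated over the same first marginal. Both functions may depend on
  \<open>x\<close>, so a test function can later be absorbed into them.\<close>

lemma concentration_limit:
  fixes \<Omega> :: "'a::euclidean_space set" and G :: "nat \<Rightarrow> 'a \<Rightarrow> 'b::euclidean_space" and \<alpha> :: "nat \<Rightarrow> real"
  assumes \<Omega>: "bounded \<Omega>" "\<Omega> \<noteq> {}" "\<Omega> \<in> sets lebesgue"
    and Gm: "\<And>n. G n \<in> borel_measurable (lebesgue_on \<Omega>)"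
    and Gi: "\<And>n. integrable (lebesgue_on \<Omega>) (\<lambda>x. (norm (G n x))\<^sup>2)"
    and GC: "\<And>n. (\<integral>x. (norm (G n x))\<^sup>2 \<partial>lebesgue_on \<Omega>) \<le> C"
    and R: "0 \<le> R" and GR: "\<And>n. AE x in lebesgue_on \<Omega>. norm (\<alpha> n *\<^sub>R G n x) \<le> R"
  obtains s :: "nat \<Rightarrow> nat" and \<pi> :: "'a measure" and \<mu> lm :: "'a \<Rightarrow> 'b measure"
  where "strict_mono s" "sets \<pi> = sets (restrict_space borel (closure \<Omega>))" "finite_measure \<pi>"
    "\<And>x. prob_space (\<mu> x)" "\<And>x. sets (\<mu> x) = sets borel" "\<And>x. emeasure (\<mu> x) (cball 0 R) = 1"
    "\<And>x. prob_space (lm x)" "\<And>x. sets (lm x) = sets borel" "\<And>x. emeasure (lm x) (sphere 0 1) = 1"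
    "\<And>f g. continuous_on (closure \<Omega> \<times> UNIV) (\<lambda>(x, A). f x A) \<Longrightarrow>
        continuous_on (closure \<Omega> \<times> UNIV) (\<lambda>(x, e). g x e) \<Longrightarrow>
        (\<forall>n. integrable (lebesgue_on \<Omega>) (\<lambda>x. (f x (\<alpha> n *\<^sub>R G n x) + g x (sgn (G n x))) * (norm (G n x))\<^sup>2)) \<and>
        integrable \<pi> (\<lambda>x. (\<integral>A. f x A \<partial>\<mu> x) + (\<integral>e. g x e \<partial>lm x)) \<and>
        (\<lambda>n. \<integral>x. (f x (\<alpha> (s n) *\<^sub>R G (s n) x) + g x (sgn (G (s n) x))) * (norm (G (s n) x))\<^sup>2 \<partial>lebesgue_on \<Omega>)
          \<longlonglongrightarrow> (\<integral>x. (\<integral>A. f x A \<partial>\<mu> x) + (\<integral>e. g x e \<partial>lm x) \<partial>\<pi>)"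
proof -
  define M where "M = lebesgue_on \<Omega>"
  have spM: "space M = \<Omega>" by (simp add: M_def space_restrict_space)
  note Gm[folded M_def, measurable] and Gi = Gi[folded M_def] and GC = GC[folded M_def] and GR = GR[folded M_def]
  have idm[measurable]: "(\<lambda>x. x) \<in> M \<rightarrow>\<^sub>M borel"
    unfolding M_def by (intro measurable_restrict_space1 measurable_completion) simp
  obtain x0 where x0: "x0 \<in> \<Omega>" using \<Omega> by auto
  obtain e0 :: 'b where e0: "norm e0 = 1" using vector_choose_size[of 1] by auto
  define K where "K = closure \<Omega> \<times> cball (0::'b) R \<times> sphere (0::'b) 1"
  have cO: "compact (closure \<Omega>)" using \<Omega> by (simp add: compact_closure)
  have K: "compact K" unfolding K_def by (intro compact_Times cO compact_cball compact_sphere)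
  have kK: "(x0, 0, e0) \<in> K" using x0 e0 R closure_subset by (auto simp: K_def)
  define m where "m n = (\<integral>x. (norm (G n x))\<^sup>2 \<partial>M)" for n
  \<comment> \<open>The subsequence is extracted in two stages: first the masses converge, then the
    normalised measures.\<close>
  have "bounded (range m)"
    unfolding bounded_iff by (rule exI[of _ C]) (use GC in \<open>auto simp: m_def\<close>)
  then obtain r1 m0 where r1: "strict_mono r1" and m0: "(m \<circ> r1) \<longlonglongrightarrow> m0"
    using bounded_imp_convergent_subsequence by blast
  have m0nn: "0 \<le> m0" by (rule LIMSEQ_le_const[OF m0]) (auto simp: m_def)
  \<comment> \<open>Where \<open>G n x = 0\<close>, \<open>sgn\<close> is 0 and would leave the
    sphere. The replacement direction \<open>e0\<close> has no effect on integrals, because the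
    weight vanishes there.\<close>
  define T where "T n x = (x, \<alpha> n *\<^sub>R G n x, if G n x = 0 then e0 else sgn (G n x))" for n x
  have Tm[measurable]: "T n \<in> M \<rightarrow>\<^sub>M borel" for n
    unfolding T_def sgn_div_norm borel_prod[symmetric] by measurable
  have TK: "AE x in M. T n x \<in> K" for n
    using GR[of n] AE_space
    by eventually_elim (use closure_subset e0 in \<open>auto simp: T_def K_def spM norm_sgn\<close>)
  \<comment> \<open>The identity keeps \<open>m n\<close> as a factor instead of dividing by it, so
    that it also covers zero mass.\<close>
  have "\<exists>P. prob_space P \<and> sets P = sets borel \<and> (AE z in P. z \<in> K) \<and>
    (\<forall>H\<in>borel_measurable borel. m n * (\<integral>z. H z \<partial>P) = (\<integral>x. H (T n x) * (norm (G n x))\<^sup>2 \<partial>M))" for n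
    unfolding m_def
    by (rule weighted_pushforward[OF Gi[of n] _ Tm compact_imp_closed[OF K] kK TK]) (simp, blast)
  then obtain P where P: "\<And>n. prob_space (P n)" "\<And>n. sets (P n) = sets borel" "\<And>n. AE z in P n. z \<in> K"
    and PH: "\<And>n H. H \<in> borel_measurable borel \<Longrightarrow> m n * (\<integral>z. H z \<partial>P n) = (\<integral>x. H (T n x) * (norm (G n x))\<^sup>2 \<partial>M)"
    by (metis (no_types))
  obtain r2 Q where r2: "strict_mono r2" and Q: "prob_space Q" "sets Q = sets borel" "AE x in Q. x \<in> K"
    and lim: "\<And>(f :: 'a \<times> 'b \<times> 'b \<Rightarrow> real) B. continuous_on UNIV f \<Longrightarrow> (\<And>x. \<bar>f x\<bar> \<le> B) \<Longrightarrow>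
      (\<lambda>n. \<integral>x. f x \<partial>P (r1 (r2 n))) \<longlonglongrightarrow> (\<integral>x. f x \<partial>Q)"
    by (rule compact_prob_measures_convergent_subsequence[OF K, of "\<lambda>n. P (r1 n)", OF P]) blast
  interpret Q: prob_space Q by fact
  define s where "s = r1 \<circ> r2"
  have s: "strict_mono s" unfolding s_def by (rule strict_mono_o[OF r1 r2])
  have ms: "(\<lambda>n. m (s n)) \<longlonglongrightarrow> m0"
    using LIMSEQ_subseq_LIMSEQ[OF m0 r2] by (simp add: s_def comp_def)
  have p1: "(\<lambda>z. (fst z, fst (snd z))) \<in> Q \<rightarrow>\<^sub>M borel" and p2: "(\<lambda>z. (fst z, snd (snd z))) \<in> Q \<rightarrow>\<^sub>M borel"
    and p0: "fst \<in> Q \<rightarrow>\<^sub>M borel"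
    unfolding measurable_cong_sets[OF Q(2) refl] by (auto intro!: borel_measurable_continuous_onI continuous_intros)
  define Q1 where "Q1 = distr Q borel (\<lambda>z. (fst z, fst (snd z)))"
  define Q2 where "Q2 = distr Q borel (\<lambda>z. (fst z, snd (snd z)))"
  define \<pi>0 where "\<pi>0 = distr Q borel fst"
  have fstb: "fst \<in> borel_measurable (borel :: ('a \<times> 'b) measure)" by (intro borel_measurable_continuous_onI continuous_intros)
  \<comment> \<open>The common first marginal is what lets both kernels be integrated against one
    measure.\<close>
  have \<pi>1: "distr Q1 borel fst = \<pi>0" and \<pi>2: "distr Q2 borel fst = \<pi>0"
    unfolding Q1_def Q2_def \<pi>0_def by (simp_all add: distr_distr[OF fstb p1] distr_distr[OF fstb p2] comp_def)
  interpret \<pi>0: prob_space \<pi>0 unfolding \<pi>0_def by (rule Q.prob_space_distr[OF p0])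
  have s\<pi>0: "sets \<pi>0 = sets borel" by (simp add: \<pi>0_def)
  have Q1: "prob_space Q1" "sets Q1 = sets borel" and Q2: "prob_space Q2" "sets Q2 = sets borel"
    unfolding Q1_def Q2_def using Q.prob_space_distr p1 p2 by auto
  have AQ1: "AE z in Q1. snd z \<in> cball 0 R" and AQ2: "AE z in Q2. snd z \<in> sphere 0 1"
  proof -
    have c: "closed {z::'a\<times>'b. snd z \<in> cball 0 R}" "closed {z::'a\<times>'b. snd z \<in> sphere 0 1}"
      using closed_vimage[of "cball (0::'b) R" "snd :: 'a\<times>'b \<Rightarrow> 'b"] closed_vimage[of "sphere (0::'b) 1" "snd :: 'a\<times>'b \<Rightarrow> 'b"]
      by (auto simp: vimage_def continuous_on_snd[OF continuous_on_id])
    show "AE z in Q1. snd z \<in> cball 0 R" unfolding Q1_def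
      by (subst AE_distr_iff[OF p1]) (use Q(3) c in \<open>auto simp: K_def elim!: eventually_mono\<close>)
    show "AE z in Q2. snd z \<in> sphere 0 1" unfolding Q2_def
      by (subst AE_distr_iff[OF p2]) (use Q(3) c in \<open>auto simp: K_def elim!: eventually_mono\<close>)
  qed
  have A\<pi>0: "AE x in \<pi>0. x \<in> closure \<Omega>" unfolding \<pi>0_def
    by (subst AE_distr_iff[OF p0]) (use Q(3) in \<open>auto simp: K_def elim!: eventually_mono\<close>)
  obtain \<mu> where \<mu>: "\<mu> \<in> borel \<rightarrow>\<^sub>M prob_algebra borel" and \<mu>K: "\<And>x. AE y in \<mu> x. y \<in> cball 0 R"
    and \<mu>f: "\<And>(f :: 'a \<times> 'b \<Rightarrow> real) B. f \<in> borel_measurable borel \<Longrightarrow> (\<And>z. \<bar>f z\<bar> \<le> B) \<Longrightarrow>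
      integral\<^sup>L Q1 f = (\<integral>x. (\<integral>y. f (x, y) \<partial>\<mu> x) \<partial>\<pi>0)"
    by (rule disintegration_compact[OF Q1 compact_cball AQ1]) (unfold \<pi>1, blast)
  obtain lm where lm: "lm \<in> borel \<rightarrow>\<^sub>M prob_algebra borel" and lmK: "\<And>x. AE y in lm x. y \<in> sphere 0 1"
    and lmf: "\<And>(f :: 'a \<times> 'b \<Rightarrow> real) B. f \<in> borel_measurable borel \<Longrightarrow> (\<And>z. \<bar>f z\<bar> \<le> B) \<Longrightarrow>
      integral\<^sup>L Q2 f = (\<integral>x. (\<integral>y. f (x, y) \<partial>lm x) \<partial>\<pi>0)"
    by (rule disintegration_compact[OF Q2 compact_sphere AQ2]) (unfold \<pi>2, blast)
  have \<mu>p: "prob_space (\<mu> x)" "sets (\<mu> x) = sets borel" and lmp: "prob_space (lm x)" "sets (lm x) = sets borel" for x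
    using measurable_space[OF \<mu>, of x] measurable_space[OF lm, of x] by (auto simp: space_prob_algebra)
  have \<mu>1: "emeasure (\<mu> x) (cball 0 R) = 1" and lm1: "emeasure (lm x) (sphere 0 1) = 1" for x
  proof -
    interpret a: prob_space "\<mu> x" by (rule \<mu>p)
    interpret b: prob_space "lm x" by (rule lmp)
    show "emeasure (\<mu> x) (cball 0 R) = 1" using \<mu>K[of x] a.AE_in_set_eq_1[of "cball 0 R"]
      by (simp add: \<mu>p a.emeasure_eq_measure del: mem_cball)
    show "emeasure (lm x) (sphere 0 1) = 1" using lmK[of x] b.AE_in_set_eq_1[of "sphere 0 1"]
      by (simp add: lmp b.emeasure_eq_measure del: mem_sphere)
  qed
  \<comment> \<open>The limit mass \<open>m0\<close>, split off by the normalisation, is put back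
    here; \<open>m0 = 0\<close> gives the zero measure. Restricting loses nothing, as
    \<open>\<pi>0\<close> is concentrated on the closure of \<Omega>.\<close>
  define \<pi> where "\<pi> = restrict_space (density \<pi>0 (\<lambda>_. ennreal m0)) (closure \<Omega>)"
  have \<pi>s: "sets \<pi> = sets (restrict_space borel (closure \<Omega>))"
    unfolding \<pi>_def by (rule sets_restrict_space_cong) (simp add: s\<pi>0)
  have sp\<pi>: "space \<pi> = closure \<Omega>" using sets_eq_imp_space_eq[OF \<pi>s] by (simp add: space_restrict_space)
  have fd: "finite_measure (density \<pi>0 (\<lambda>_. ennreal m0))"
    by (rule finite_measureI) (simp add: emeasure_density_const \<pi>0.emeasure_space_1)
  have f\<pi>: "finite_measure \<pi>"
    unfolding \<pi>_def by (rule finite_measure_restrict_space[OF fd]) (simp add: s\<pi>0)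
  have \<pi>int: "(\<integral>x. h x \<partial>\<pi>) = m0 * (\<integral>x. h x \<partial>\<pi>0)" if h: "h \<in> borel_measurable borel" for h :: "'a \<Rightarrow> real"
  proof -
    have [measurable]: "h \<in> borel_measurable \<pi>0" "closure \<Omega> \<in> sets \<pi>0"
      using h by (simp_all add: measurable_cong_sets[OF s\<pi>0 refl] s\<pi>0)
    have "(\<integral>x. h x \<partial>\<pi>) = (\<integral>x. indicator (closure \<Omega>) x *\<^sub>R h x \<partial>density \<pi>0 (\<lambda>_. ennreal m0))"
      unfolding \<pi>_def by (rule integral_restrict_space) (simp add: s\<pi>0)
    also have "\<dots> = (\<integral>x. m0 *\<^sub>R (indicator (closure \<Omega>) x *\<^sub>R h x) \<partial>\<pi>0)"
      by (rule integral_density) (use m0nn in auto)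
    also have "\<dots> = (\<integral>x. m0 * h x \<partial>\<pi>0)"
    proof (rule integral_cong_AE)
      show "AE x in \<pi>0. m0 *\<^sub>R (indicator (closure \<Omega>) x *\<^sub>R h x) = m0 * h x"
        using A\<pi>0 by eventually_elim simp
    qed measurable
    finally show ?thesis by simp
  qed
  have main: "(\<forall>n. integrable M (\<lambda>x. (f x (\<alpha> n *\<^sub>R G n x) + g x (sgn (G n x))) * (norm (G n x))\<^sup>2)) \<and>
        integrable \<pi> (\<lambda>x. (\<integral>A. f x A \<partial>\<mu> x) + (\<integral>e. g x e \<partial>lm x)) \<and>
        (\<lambda>n. \<integral>x. (f x (\<alpha> (s n) *\<^sub>R G (s n) x) + g x (sgn (G (s n) x))) * (norm (G (s n) x))\<^sup>2 \<partial>M)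
          \<longlonglongrightarrow> (\<integral>x. (\<integral>A. f x A \<partial>\<mu> x) + (\<integral>e. g x e \<partial>lm x) \<partial>\<pi>)"
    if f: "continuous_on (closure \<Omega> \<times> UNIV) (\<lambda>(x, A). f x A)"
      and g: "continuous_on (closure \<Omega> \<times> UNIV) (\<lambda>(x, e). g x e)" for f g
  proof -
    have clO: "closedin (top_of_set UNIV) (closure \<Omega> \<times> (UNIV::'b set))" by (simp add: closed_Times)
    \<comment> \<open>Two kinds of extension are used. The possibly unbounded \<open>f'\<close> and
      \<open>g'\<close> agree with \<open>f\<close> and \<open>g\<close> for every second argument
      and give measurability. The bounded \<open>F\<close> and \<open>E\<close> below agree with
      them only over the ball and the sphere, and serve as test functions for the weak
      convergence.\<close>
    obtain f' where f': "continuous_on UNIV f'" "\<And>z. z \<in> closure \<Omega> \<times> UNIV \<Longrightarrow> f' z = (\<lambda>(x, A). f x A) z"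
      by (rule Tietze_unbounded[OF f clO]) blast
    obtain g' where g': "continuous_on UNIV g'" "\<And>z. z \<in> closure \<Omega> \<times> UNIV \<Longrightarrow> g' z = (\<lambda>(x, A). g x A) z"
      by (rule Tietze_unbounded[OF g clO]) blast
    have f'm: "f' \<in> borel_measurable borel" and g'm: "g' \<in> borel_measurable borel"
      using f' g' by (auto intro: borel_measurable_continuous_onI)
    have cf: "continuous_on (closure \<Omega> \<times> cball 0 R) (\<lambda>(x, A). f x A)"
      and cg: "continuous_on (closure \<Omega> \<times> sphere 0 1) (\<lambda>(x, A). g x A)"
      using continuous_on_subset[OF f, of "closure \<Omega> \<times> cball 0 R"]
        continuous_on_subset[OF g, of "closure \<Omega> \<times> sphere 0 1"] by (simp_all add: Sigma_mono)
    obtain F B1 where F: "continuous_on UNIV F" "\<And>z. \<bar>F z\<bar> \<le> B1" "\<And>z. z \<in> closure \<Omega> \<times> cball 0 R \<Longrightarrow> F z = (\<lambda>(x, A). f x A) z"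
      by (rule continuous_on_compact_bounded_extension[OF compact_Times[OF cO compact_cball] cf]) blast
    obtain E B2 where E: "continuous_on UNIV E" "\<And>z. \<bar>E z\<bar> \<le> B2" "\<And>z. z \<in> closure \<Omega> \<times> sphere 0 1 \<Longrightarrow> E z = (\<lambda>(x, A). g x A) z"
      by (rule continuous_on_compact_bounded_extension[OF compact_Times[OF cO compact_sphere] cg]) blast
    have Fm: "F \<in> borel_measurable borel" and Em: "E \<in> borel_measurable borel"
      using F E by (auto intro: borel_measurable_continuous_onI)
    define H where "H z = F (fst z, fst (snd z)) + E (fst z, snd (snd z))" for z
    have Hc: "continuous_on UNIV H" unfolding H_def
      by (intro continuous_on_add continuous_on_compose2[OF F(1)] continuous_on_compose2[OF E(1)] continuous_intros) auto
    have Hb: "\<bar>H z\<bar> \<le> B1 + B2" for z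
      using F(2)[of "(fst z, fst (snd z))"] E(2)[of "(fst z, snd (snd z))"] by (simp add: H_def)
    have Hm[measurable]: "H \<in> borel_measurable borel" using Hc by (rule borel_measurable_continuous_onI)
    let ?I = "\<lambda>n x. (f x (\<alpha> n *\<^sub>R G n x) + g x (sgn (G n x))) * (norm (G n x))\<^sup>2"
    have Im: "?I n \<in> borel_measurable M" for n
    proof -
      have "(\<lambda>x. (x, \<alpha> n *\<^sub>R G n x)) \<in> M \<rightarrow>\<^sub>M borel" "(\<lambda>x. (x, sgn (G n x))) \<in> M \<rightarrow>\<^sub>M borel"
        unfolding sgn_div_norm borel_prod[symmetric] by measurable
      from measurable_compose[OF this(1) f'm] measurable_compose[OF this(2) g'm]
      have "(\<lambda>x. (f' (x, \<alpha> n *\<^sub>R G n x) + g' (x, sgn (G n x))) * (norm (G n x))\<^sup>2) \<in> borel_measurable M"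
        by measurable
      then show ?thesis
        by (rule measurable_cong[THEN iffD1, rotated]) (use f'(2) g'(2) closure_subset in \<open>force simp: spM\<close>)
    qed
    \<comment> \<open>Almost everywhere the rescaled field lies in the ball, where \<open>F\<close>
      agrees with \<open>f\<close>. Points with \<open>G n x = 0\<close> are covered by the
      vanishing weight.\<close>
    have AEI: "AE x in M. ?I n x = H (T n x) * (norm (G n x))\<^sup>2" for n
      using GR[of n] AE_space
    proof eventually_elim
      case (elim x)
      have x: "x \<in> closure \<Omega>" using elim closure_subset by (auto simp: spM)
      show ?case
      proof (cases "G n x = 0")
        case False
        then have "F (x, \<alpha> n *\<^sub>R G n x) = f x (\<alpha> n *\<^sub>R G n x)" "E (x, sgn (G n x)) = g x (sgn (G n x))"
          using x elim F(3)[of "(x, \<alpha> n *\<^sub>R G n x)"] E(3)[of "(x, sgn (G n x))"] by (auto simp: norm_sgn)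
        then show ?thesis using False by (simp add: H_def T_def)
      qed simp
    qed
    have HTm[measurable]: "(\<lambda>x. H (T n x)) \<in> borel_measurable M" for n using measurable_compose[OF Tm Hm] .
    have "integrable M (\<lambda>x. H (T n x) * (norm (G n x))\<^sup>2)" for n
    proof (rule Bochner_Integration.integrable_bound)
      show "integrable M (\<lambda>x. (B1 + B2) * (norm (G n x))\<^sup>2)" using Gi by simp
      show "AE x in M. norm (H (T n x) * (norm (G n x))\<^sup>2) \<le> norm ((B1 + B2) * (norm (G n x))\<^sup>2)"
      proof (rule AE_I2)
        fix x
        have "\<bar>H (T n x)\<bar> \<le> \<bar>B1 + B2\<bar>" using Hb[of "T n x"] by linarith
        then show "norm (H (T n x) * (norm (G n x))\<^sup>2) \<le> norm ((B1 + B2) * (norm (G n x))\<^sup>2)"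
          by (simp add: abs_mult mult_right_mono)
      qed
    qed measurable
    then have int: "integrable M (?I n)" for n
      using integrable_cong_AE[OF Im _ AEI[of n]] by (metis HTm borel_measurable_integrable)
    have eq: "(\<integral>x. ?I n x \<partial>M) = m n * (\<integral>z. H z \<partial>P n)" for n
      unfolding PH[OF Hm] by (rule integral_cong_AE[OF Im _ AEI]) measurable
    \<comment> \<open>A bounded Borel version of the limit integrand on the whole space; on the
      closure of \<Omega> it coincides with the one built from \<open>f\<close> and
      \<open>g\<close>.\<close>
    define h where "h x = (\<integral>A. F (x, A) \<partial>\<mu> x) + (\<integral>e. E (x, e) \<partial>lm x)" for x
    have hm1: "(\<lambda>x. \<integral>A. F (x, A) \<partial>\<mu> x) \<in> borel_measurable borel" by (rule borel_measurable_kernel_integral[OF \<mu> Fm])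
    have hm2: "(\<lambda>x. \<integral>e. E (x, e) \<partial>lm x) \<in> borel_measurable borel" by (rule borel_measurable_kernel_integral[OF lm Em])
    have hm: "h \<in> borel_measurable borel" unfolding h_def using hm1 hm2 by measurable
    have sect: "(\<lambda>y. (x, y)) \<in> borel \<rightarrow>\<^sub>M (borel :: ('a \<times> 'b) measure)" for x
      by (intro borel_measurable_continuous_onI continuous_intros)
    have hb1: "\<bar>\<integral>A. F (x, A) \<partial>\<mu> x\<bar> \<le> B1" and hb2: "\<bar>\<integral>e. E (x, e) \<partial>lm x\<bar> \<le> B2" for x
      using measurable_compose[OF sect Fm, of x] measurable_compose[OF sect Em, of x]
      by (auto intro!: prob_abs_integral_le \<mu>p(1) lmp(1) F(2) E(2)
        simp: measurable_cong_sets[OF \<mu>p(2) refl] measurable_cong_sets[OF lmp(2) refl])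
    have hh: "(\<integral>A. f x A \<partial>\<mu> x) + (\<integral>e. g x e \<partial>lm x) = h x" if x: "x \<in> closure \<Omega>" for x
    proof -
      have fx: "f x = (\<lambda>A. f' (x, A))" and gx: "g x = (\<lambda>e. g' (x, e))"
        using x f'(2) g'(2) by auto
      have "(\<integral>A. f x A \<partial>\<mu> x) = (\<integral>A. F (x, A) \<partial>\<mu> x)"
      proof (rule integral_cong_AE)
        show "f x \<in> borel_measurable (\<mu> x)" "(\<lambda>A. F (x, A)) \<in> borel_measurable (\<mu> x)"
          unfolding fx measurable_cong_sets[OF \<mu>p(2) refl]
          using measurable_compose[OF sect f'm] measurable_compose[OF sect Fm] by auto
        show "AE A in \<mu> x. f x A = F (x, A)"
          using \<mu>K[of x] by eventually_elim (use x F(3) in auto)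
      qed
      moreover have "(\<integral>e. g x e \<partial>lm x) = (\<integral>e. E (x, e) \<partial>lm x)"
      proof (rule integral_cong_AE)
        show "g x \<in> borel_measurable (lm x)" "(\<lambda>e. E (x, e)) \<in> borel_measurable (lm x)"
          unfolding gx measurable_cong_sets[OF lmp(2) refl]
          using measurable_compose[OF sect g'm] measurable_compose[OF sect Em] by auto
        show "AE e in lm x. g x e = E (x, e)"
          using lmK[of x] by eventually_elim (use x E(3) in auto)
      qed
      ultimately show ?thesis by (simp add: h_def)
    qed
    have int\<pi>: "integrable \<pi> h"
    proof -
      interpret finite_measure \<pi> by (rule f\<pi>)
      show ?thesis
      proof (rule integrable_const_bound[of _ "B1 + B2"])
        show "AE x in \<pi>. norm (h x) \<le> B1 + B2" unfolding h_def real_norm_def by (intro AE_I2 order_trans[OF abs_triangle_ineq] add_mono hb1 hb2)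
        show "h \<in> borel_measurable \<pi>" unfolding measurable_cong_sets[OF \<pi>s refl] using hm by (rule measurable_restrict_space1)
      qed
    qed
    have "(\<lambda>n. m (s n) * (\<integral>z. H z \<partial>P (s n))) \<longlonglongrightarrow> m0 * (\<integral>z. H z \<partial>Q)"
      using lim[OF Hc Hb] by (intro tendsto_mult ms) (simp add: s_def)
    moreover have "m0 * (\<integral>z. H z \<partial>Q) = (\<integral>x. h x \<partial>\<pi>)"
    proof -
      have i1: "integrable Q (\<lambda>z. F (fst z, fst (snd z)))"
        by (rule Q.integrable_const_bound[of _ B1]) (use F(2) measurable_compose[OF p1 Fm] in auto)
      have i2: "integrable Q (\<lambda>z. E (fst z, snd (snd z)))"
        by (rule Q.integrable_const_bound[of _ B2]) (use E(2) measurable_compose[OF p2 Em] in auto)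
      \<comment> \<open>\<open>H\<close> is a function of (x, A) plus a function of (x, e), so the
        joint law of A and e drops out.\<close>
      have "(\<integral>z. H z \<partial>Q) = integral\<^sup>L Q1 F + integral\<^sup>L Q2 E"
        unfolding H_def Q1_def Q2_def integral_distr[OF p1 Fm] integral_distr[OF p2 Em]
        by (rule Bochner_Integration.integral_add[OF i1 i2])
      also have "\<dots> = (\<integral>x. (\<integral>A. F (x, A) \<partial>\<mu> x) \<partial>\<pi>0) + (\<integral>x. (\<integral>e. E (x, e) \<partial>lm x) \<partial>\<pi>0)"
        by (simp add: \<mu>f[OF Fm F(2)] lmf[OF Em E(2)])
      also have "\<dots> = (\<integral>x. h x \<partial>\<pi>0)" unfolding h_def
      proof (rule Bochner_Integration.integral_add[symmetric])
        show "integrable \<pi>0 (\<lambda>x. \<integral>A. F (x, A) \<partial>\<mu> x)"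
          by (rule \<pi>0.integrable_const_bound[of _ B1]) (use hb1 hm1 in \<open>auto simp: measurable_cong_sets[OF s\<pi>0 refl]\<close>)
        show "integrable \<pi>0 (\<lambda>x. \<integral>e. E (x, e) \<partial>lm x)"
          by (rule \<pi>0.integrable_const_bound[of _ B2]) (use hb2 hm2 in \<open>auto simp: measurable_cong_sets[OF s\<pi>0 refl]\<close>)
      qed
      finally show ?thesis using \<pi>int[OF hm] by simp
    qed
    moreover have "(\<integral>x. (\<integral>A. f x A \<partial>\<mu> x) + (\<integral>e. g x e \<partial>lm x) \<partial>\<pi>) = (\<integral>x. h x \<partial>\<pi>)"
      by (rule Bochner_Integration.integral_cong) (auto simp: sp\<pi> hh)
    moreover have "integrable \<pi> (\<lambda>x. (\<integral>A. f x A \<partial>\<mu> x) + (\<integral>e. g x e \<partial>lm x))"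
      using int\<pi> by (rule Bochner_Integration.integrable_cong[THEN iffD1, rotated 2]) (auto simp: sp\<pi> hh)
    ultimately show ?thesis using int eq by simp
  qed
  show thesis by (rule that[OF s \<pi>s f\<pi> \<mu>p \<mu>1 lmp lm1 main[unfolded M_def]])
qed

section \<open>Application to the gradients: the integrand in polar form and the bound by
  \<open>R\<close>\<close>

text \<open>The quadratic term is homogeneous of degree two, so a factor
  \<open>(norm G)\<^sup>2\<close> splits off and only the direction remains. At \<open>G = 0\<close>
  both sides vanish.\<close>

lemma calF_eq:
  "calF U L x \<alpha> G = (U x (\<alpha> *\<^sub>R G) + 1/2 * inner (blinfun_apply (L x) (sgn G)) (sgn G)) * (norm G)\<^sup>2"
  by (cases "G = 0")
     (simp_all add: calF_def sgn_div_norm blinfun.scaleR_right power2_eq_square field_simps)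

lemma continuous_on_quadratic_form:
  fixes L :: "'a::topological_space \<Rightarrow> ('b::euclidean_space \<Rightarrow>\<^sub>L 'b)"
  assumes "continuous_on S L"
  shows "continuous_on (S \<times> UNIV) (\<lambda>(x, e). inner (blinfun_apply (L x) e) e)"
proof -
  have "continuous_on (S \<times> UNIV) (\<lambda>z::'a \<times> 'b. L (fst z))"
    by (rule continuous_on_compose2[OF assms continuous_on_fst[OF continuous_on_id]]) auto
  then show ?thesis
    unfolding case_prod_beta by (intro continuous_intros)
qed

lemma continuous_on_fst_comp:
  assumes "continuous_on S f"
  shows "continuous_on (S \<times> T) (\<lambda>(x, y). f x)"
  unfolding case_prod_beta
  by (rule continuous_on_compose2[OF assms continuous_on_fst[OF continuous_on_id]]) auto

text \<open>In the application \<open>f\<close> is the sequence of gradients and \<open>g\<close>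
  that of the functions. Since \<open>real_of_ereal\<close> sends infinite values to 0, the supremum
  must first be shown to be finite: it lies between 0 and \<open>C\<close>.\<close>

lemma AE_norm_le_SUP_ess_norm:
  fixes \<Omega> :: "(real^'d::finite) set" and f :: "nat \<Rightarrow> real^'d \<Rightarrow> 'b::real_normed_vector"
    and g :: "nat \<Rightarrow> real^'d \<Rightarrow> 'c::real_normed_vector"
  assumes \<Omega>: "open \<Omega>" "\<Omega> \<noteq> {}"
    and C: "\<And>n. ess_norm \<Omega> (g n) + ess_norm \<Omega> (f n) \<le> ereal C"
    and R: "R = real_of_ereal (SUP n. ess_norm \<Omega> (f n))"
  shows "0 \<le> R" "AE x in lebesgue_on \<Omega>. norm (f n x) \<le> R"
proof -
  \<comment> \<open>On a null space an essential supremum would be minus infinity. Positive measure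
    makes the essential norms nonnegative, so that the bound on the sum bounds each summand.\<close>
  have "emeasure lebesgue \<Omega> \<noteq> 0"
    using \<Omega> open_not_negligible[OF \<Omega>] by (auto simp: negligible_iff_emeasure0)
  then have pos: "emeasure (lebesgue_on \<Omega>) (space (lebesgue_on \<Omega>)) \<noteq> 0"
    using \<Omega> by (simp add: emeasure_restrict_space space_restrict_space)
  have nn: "0 \<le> ess_norm \<Omega> h" for h :: "real^'d \<Rightarrow> 'z::real_normed_vector"
  proof -
    have "(0::ereal) = esssup (lebesgue_on \<Omega>) (\<lambda>x. 0)" using esssup_const[OF pos] by simp
    also have "\<dots> \<le> ess_norm \<Omega> h" unfolding ess_norm_def by (rule esssup_mono) auto
    finally show ?thesis .
  qed
  define S where "S = (SUP n. ess_norm \<Omega> (f n))"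
  have "ess_norm \<Omega> (f n) \<le> ereal C" for n
    using C[of n] nn[of "g n"] add_increasing[OF nn[of "g n"], of "ess_norm \<Omega> (f n)" "ess_norm \<Omega> (f n)"] by auto
  then have "S \<le> ereal C" unfolding S_def by (rule SUP_least)
  moreover have S0: "0 \<le> S" unfolding S_def using nn[of "f 0"] by (rule order_trans) (rule SUP_upper, simp)
  ultimately have SR: "S = ereal R" unfolding R S_def[symmetric] by (cases S) auto
  show "0 \<le> R" using S0 SR by simp
  have "AE x in lebesgue_on \<Omega>. ereal (norm (f n x)) \<le> ess_norm \<Omega> (f n)"
    unfolding ess_norm_def by (rule esssup_AE)
  then show "AE x in lebesgue_on \<Omega>. norm (f n x) \<le> R"
  proof eventually_elim
    case (elim x)
    have "ess_norm \<Omega> (f n) \<le> ereal R" unfolding SR[symmetric] S_def by (rule SUP_upper) simp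
    with elim have "ereal (norm (f n x)) \<le> ereal R" by (rule order_trans)
    then show ?case by simp
  qed
qed

theorem theorem5p1:
  fixes \<Omega> :: "(real^'d::finite) set"
    and \<psi> :: "nat \<Rightarrow> real^'d \<Rightarrow> real^'m::finite"
    and D\<psi> :: "nat \<Rightarrow> real^'d \<Rightarrow> real^'d^'m"
    and \<alpha> :: "nat \<Rightarrow> real"
    and R :: real
  assumes dom: "bounded_C1_domain \<Omega>"
    and W12: "\<forall>n. W12 \<Omega> (\<psi> n) (D\<psi> n)"
    and W12_bdd: "\<exists>C. \<forall>n. W12_norm_sq \<Omega> (\<psi> n) (D\<psi> n) \<le> C"
    and alpha_pos: "\<forall>n. \<alpha> n > 0"
    and W1inf: "\<forall>n. W1inf \<Omega> (\<lambda>x. \<alpha> n *\<^sub>R \<psi> n x) (\<lambda>x. \<alpha> n *\<^sub>R D\<psi> n x)"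
    and W1inf_bdd: "\<exists>C::real. \<forall>n. ess_norm \<Omega> (\<lambda>x. \<alpha> n *\<^sub>R \<psi> n x)
                                  + ess_norm \<Omega> (\<lambda>x. \<alpha> n *\<^sub>R D\<psi> n x) \<le> ereal C"
    and R_def: "R = real_of_ereal (SUP n. ess_norm \<Omega> (\<lambda>x. \<alpha> n *\<^sub>R D\<psi> n x))"
  shows "\<exists>s::nat \<Rightarrow> nat. \<exists>\<pi> :: (real^'d) measure.
           \<exists>\<mu> :: real^'d \<Rightarrow> (real^'d^'m) measure. \<exists>lm :: real^'d \<Rightarrow> (real^'d^'m) measure.
     strict_mono s \<and>
     sets \<pi> = sets (restrict_space borel (closure \<Omega>)) \<and> finite_measure \<pi> \<and>
     (\<forall>x\<in>closure \<Omega>. prob_space (\<mu> x) \<and> sets (\<mu> x) = sets borel \<and> emeasure (\<mu> x) (cball 0 R) = 1) \<and>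
     (\<forall>x\<in>closure \<Omega>. prob_space (lm x) \<and> sets (lm x) = sets borel \<and> emeasure (lm x) (sphere 0 1) = 1) \<and>
     (\<forall>(U :: real^'d \<Rightarrow> real^'d^'m \<Rightarrow> real) (L :: real^'d \<Rightarrow> ((real^'d^'m) \<Rightarrow>\<^sub>L (real^'d^'m))).
        continuous_on (closure \<Omega> \<times> UNIV) (\<lambda>(x, F). U x F) \<and> (\<forall>x\<in>closure \<Omega>. U x 0 = 0) \<and>
        continuous_on (closure \<Omega>) L \<longrightarrow>
        weak_star_conv \<Omega> (\<lambda>n x. calF U L x (\<alpha> (s n)) (D\<psi> (s n) x)) \<pi>
          (\<lambda>x. calI U L x (\<mu> x) (lm x))) \<and>
     weak_star_conv \<Omega> (\<lambda>n x. (norm (D\<psi> (s n) x))\<^sup>2) \<pi> (\<lambda>x. 1)"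
proof -
  have \<Omega>: "open \<Omega>" "\<Omega> \<noteq> {}" "bounded \<Omega>" "\<Omega> \<in> sets lebesgue"
    using dom by (auto simp: bounded_C1_domain_def)
  have Gm: "D\<psi> n \<in> borel_measurable (lebesgue_on \<Omega>)" "integrable (lebesgue_on \<Omega>) (\<lambda>x. (norm (D\<psi> n x))\<^sup>2)" for n
    using W12 by (auto simp: W12_def)
  obtain C where C: "\<And>n. W12_norm_sq \<Omega> (\<psi> n) (D\<psi> n) \<le> C" using W12_bdd by auto
  have GC: "(\<integral>x. (norm (D\<psi> n x))\<^sup>2 \<partial>lebesgue_on \<Omega>) \<le> C" for n
  proof -
    have "0 \<le> (\<integral>x. (norm (\<psi> n x))\<^sup>2 \<partial>lebesgue_on \<Omega>)" by simp
    then show ?thesis using C[of n] unfolding W12_norm_sq_def by linarith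
  qed
  obtain C' where C': "\<And>n. ess_norm \<Omega> (\<lambda>x. \<alpha> n *\<^sub>R \<psi> n x) + ess_norm \<Omega> (\<lambda>x. \<alpha> n *\<^sub>R D\<psi> n x) \<le> ereal C'"
    using W1inf_bdd by auto
  note R = AE_norm_le_SUP_ess_norm[OF \<Omega>(1,2) C' R_def]
  obtain s \<pi> \<mu> lm where s: "strict_mono s"
    and \<pi>: "sets \<pi> = sets (restrict_space borel (closure \<Omega>))" "finite_measure \<pi>"
    and \<mu>: "\<And>x. prob_space (\<mu> x)" "\<And>x. sets (\<mu> x) = sets borel" "\<And>x. emeasure (\<mu> x) (cball 0 R) = 1"
    and lm: "\<And>x. prob_space (lm x)" "\<And>x. sets (lm x) = sets borel" "\<And>x. emeasure (lm x) (sphere 0 1) = 1"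
    and lim: "\<And>f g. continuous_on (closure \<Omega> \<times> UNIV) (\<lambda>(x, A). f x A) \<Longrightarrow>
        continuous_on (closure \<Omega> \<times> UNIV) (\<lambda>(x, e). g x e) \<Longrightarrow>
        (\<forall>n. integrable (lebesgue_on \<Omega>) (\<lambda>x. (f x (\<alpha> n *\<^sub>R D\<psi> n x) + g x (sgn (D\<psi> n x))) * (norm (D\<psi> n x))\<^sup>2)) \<and>
        integrable \<pi> (\<lambda>x. (\<integral>A. f x A \<partial>\<mu> x) + (\<integral>e. g x e \<partial>lm x)) \<and>
        (\<lambda>n. \<integral>x. (f x (\<alpha> (s n) *\<^sub>R D\<psi> (s n) x) + g x (sgn (D\<psi> (s n) x))) * (norm (D\<psi> (s n) x))\<^sup>2 \<partial>lebesgue_on \<Omega>)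
          \<longlonglongrightarrow> (\<integral>x. (\<integral>A. f x A \<partial>\<mu> x) + (\<integral>e. g x e \<partial>lm x) \<partial>\<pi>)"
    by (rule concentration_limit[where G=D\<psi> and \<alpha>=\<alpha>, OF \<Omega>(3,2,4) Gm GC R]) blast
  have conv: "weak_star_conv \<Omega> (\<lambda>n x. calF U L x (\<alpha> (s n)) (D\<psi> (s n) x)) \<pi> (\<lambda>x. calI U L x (\<mu> x) (lm x))"
    if U: "continuous_on (closure \<Omega> \<times> UNIV) (\<lambda>(x, F). U x F)" and L: "continuous_on (closure \<Omega>) L" for U L
  proof -
    define q where "q x e = 1/2 * inner (blinfun_apply (L x) e) e" for x e
    have q: "continuous_on (closure \<Omega> \<times> UNIV) (\<lambda>(x, e). q x e)"
      unfolding q_def case_prod_beta using continuous_on_quadratic_form[OF L]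
      by (intro continuous_on_mult continuous_on_const) (simp add: case_prod_beta)
    have F: "calF U L x a A = (U x (a *\<^sub>R A) + q x (sgn A)) * (norm A)\<^sup>2" for x a A
      by (simp add: calF_eq q_def)
    have I: "calI U L x (\<mu> x) (lm x) = (\<integral>A. U x A \<partial>\<mu> x) + (\<integral>e. q x e \<partial>lm x)" for x
      by (simp add: calI_def q_def)
    show ?thesis unfolding weak_star_conv_def
    proof (intro conjI allI impI)
      show "integrable (lebesgue_on \<Omega>) (\<lambda>x. calF U L x (\<alpha> (s n)) (D\<psi> (s n) x))" for n
        unfolding F using lim[OF U q] by blast
      show "integrable \<pi> (\<lambda>x. calI U L x (\<mu> x) (lm x))"
        unfolding I using lim[OF U q] by blast
      fix \<phi> :: "real^'d \<Rightarrow> real" assume \<phi>: "continuous_on (closure \<Omega>) \<phi>"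
      have \<phi>': "continuous_on (closure \<Omega> \<times> (UNIV :: (real^'d^'m) set)) (\<lambda>(x, y). \<phi> x)"
        by (rule continuous_on_fst_comp[OF \<phi>])
      \<comment> \<open>The test function is absorbed into both integrands, which reduces weak-star
        convergence to convergence of the integrals in \<open>lim\<close>.\<close>
      have 1: "continuous_on (closure \<Omega> \<times> UNIV) (\<lambda>(x, A). \<phi> x * U x A)"
        and 2: "continuous_on (closure \<Omega> \<times> UNIV) (\<lambda>(x, e). \<phi> x * q x e)"
        using continuous_on_mult[OF \<phi>' U] continuous_on_mult[OF \<phi>' q] by (simp_all add: case_prod_beta)
      have a: "\<phi> x * calF U L x a A = (\<phi> x * U x (a *\<^sub>R A) + \<phi> x * q x (sgn A)) * (norm A)\<^sup>2" for x a A
        by (simp add: F algebra_simps)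
      have b: "\<phi> x * calI U L x (\<mu> x) (lm x) = (\<integral>A. \<phi> x * U x A \<partial>\<mu> x) + (\<integral>e. \<phi> x * q x e \<partial>lm x)" for x
        by (simp add: I algebra_simps)
      show "(\<lambda>n. \<integral>x. \<phi> x * calF U L x (\<alpha> (s n)) (D\<psi> (s n) x) \<partial>lebesgue_on \<Omega>)
          \<longlonglongrightarrow> (\<integral>x. \<phi> x * calI U L x (\<mu> x) (lm x) \<partial>\<pi>)"
        unfolding a b using lim[OF 1 2] by blast
    qed
  qed
  have conv1: "weak_star_conv \<Omega> (\<lambda>n x. (norm (D\<psi> (s n) x))\<^sup>2) \<pi> (\<lambda>x. 1)"
    unfolding weak_star_conv_def
  proof (intro conjI allI impI)
    show "integrable \<pi> (\<lambda>x. 1)" using finite_measure.integrable_const[OF \<pi>(2)] by blast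
    fix \<phi> :: "real^'d \<Rightarrow> real" assume \<phi>: "continuous_on (closure \<Omega>) \<phi>"
    \<comment> \<open>Here \<open>lim\<close> is used with \<open>f x A = \<phi> x\<close> and
      \<open>g = 0\<close>; as \<open>\<mu> x\<close> has mass one, the inner integral is
      \<open>\<phi> x\<close>.\<close>
    show "(\<lambda>n. \<integral>x. \<phi> x * (norm (D\<psi> (s n) x))\<^sup>2 \<partial>lebesgue_on \<Omega>) \<longlonglongrightarrow> (\<integral>x. \<phi> x * 1 \<partial>\<pi>)"
      using lim[OF continuous_on_fst_comp[OF \<phi>] continuous_on_fst_comp[OF continuous_on_const[of _ "0::real"]]]
      by (simp add: prob_space.prob_space[OF \<mu>(1)])
  qed (rule Gm)
  show ?thesis
    by (rule exI[of _ s], rule exI[of _ \<pi>], rule exI[of _ \<mu>], rule exI[of _ lm])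
       (use s \<pi> \<mu> lm conv conv1 in auto)
qed

end
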